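(* Let $\Omega\subset\mathbb{R}^d$ be compact and convex, let $\mu,\nu\in\mathcal{P}(\Omega)$ with $\mu\ll\mathcal{L}_d$ and $W_1(\mu,\nu)>0$, let $\theta\in(0,1)$, and let $T_0$ be an optimal transport map for the pair $(\mu,\nu)$. Set $\mu_0:=\mu$ and, for $n=1,2,\dots$, $\mu_n=(f_{n-1})_\#\mu_{n-1}$, where $$f_{n-1}(x)=\begin{cases}x-\eta_{n-1}\nabla u_{n-1}(x)&\text{if }\nabla u_{n-1}(x)\text{ exists},\\ x&\text{else,}\end{cases}\qquad \eta_{n-1}=\theta\,W_1(\mu_{n-1},\nu),$$ and $u_{n-1}$ is a Kantorovich potential for the pair $(\mu_{n-1},\nu)$. Let $$N(\theta)=\left\lceil \log_{1-\theta}\left(1-\frac{\ell_0(T_0)}{W_1(\mu_0,\nu)}\right)\right\rceil-1 .$$ Then $$W_1(\mu_n,\nu)=(1-\theta)^n\,W_1(\mu,\nu)\qquad\text{for all } n\in\{0,\dots,N(\theta)\}.$$ In particular, if $\ell_0(T_0)<W_1(\mu,\nu)$ (and $N(\theta)\ge 0$, so that $\mu_{N(\theta)}$ is defined), then $$W_1(\mu_{N(\theta)},\nu)\le\frac{W_1(\mu,\nu)-\ell_0(T_0)}{1-\theta}.$$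
   Context: $\mathcal{P}(\Omega)$ is the set of probability measures on $\Omega$; $\mathcal{L}_d$ is Lebesgue measure on $\mathbb{R}^d$; $\mu\ll\mathcal{L}_d$ means that $\mu$ has a density with respect to $\mathcal{L}_d$; $|\cdot|$ is the Euclidean norm; $\lceil\cdot\rceil$ is the ceiling function. The pushforward is $T_\#\mu(E)=\mu(T^{-1}(E))$. $W_1(\mu,\nu)=\min_{\gamma\in\Pi(\mu,\nu)}\int_{\Omega\times\Omega}|x-y|\,d\gamma$, where $\Pi(\mu,\nu)$ is the set of probability measures on $\Omega\times\Omega$ with first marginal $\mu$ and second marginal $\nu$. A Kantorovich potential for the pair $(\mu,\nu)$ is a maximizer of $\int_\Omega u\,d\mu-\int_\Omega u\,d\nu$ over all functions $u:\Omega\to\mathbb{R}$ that are Lipschitz with constant $1$. At each step of the iteration an arbitrary Kantorovich potential $u_{n-1}$ is chosen. An optimal transport map for $(\mu,\nu)$ is a map $T_0:\Omega\to\Omega$ that minimizes $\int_\Omega|x-T(x)|\,d\mu$ over maps $T:\Omega\to\Omega$ with $T_\#\mu=\nu$. For such $T_0$, $$\ell_0(T_0):=\operatorname{ess\,inf}_\mu|I-T_0|=\sup\{\ell\in\mathbb{R}\mid \mu(\{x\in\Omega\mid |x-T_0(x)|<\ell\})=0\}.$$ Conventions: if $\ell_0(T_0)=W_1(\mu,\nu)$ then $\log_{1-\theta}(0)=+\infty$ and $N(\theta)=+\infty$, so the first conclusion is for all $n\ge0$. If $\ell_0(T_0)=0$ then $N(\theta)=-1$ and the range of $n$ is empty.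 *)

theory Defs
  imports "HOL-Probability.Probability"
begin

text \<open>
  A probability measure on \<open>S\<close> is represented as a Borel measure on the whole space that gives
  \<open>S\<close> mass 1. The ambient representation is needed because the step map below takes values in
  the ambient space and need not map every point of the domain back into it.
\<close>

definition prob_measures_on :: "'a::topological_space set \<Rightarrow> 'a measure set" where
  "prob_measures_on S = {\<mu>. prob_space \<mu> \<and> sets \<mu> = sets borel \<and> emeasure \<mu> S = 1}"

definition couplings ::
    "'a::euclidean_space set \<Rightarrow> 'a measure \<Rightarrow> 'a measure \<Rightarrow> ('a \<times> 'a) measure set" where
  "couplings \<Omega> \<mu> \<nu> =
     {\<gamma> \<in> prob_measures_on (\<Omega> \<times> \<Omega>). distr \<gamma> borel fst = \<mu> \<and> distr \<gamma> borel snd = \<nu>}"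

definition W1 :: "'a::euclidean_space set \<Rightarrow> 'a measure \<Rightarrow> 'a measure \<Rightarrow> real" where
  "W1 \<Omega> \<mu> \<nu> = (INF \<gamma>\<in>couplings \<Omega> \<mu> \<nu>. LINT z:\<Omega> \<times> \<Omega>|\<gamma>. norm (fst z - snd z))"

text \<open>Only the values of \<open>u\<close> on \<open>\<Omega>\<close> matter.\<close>

definition kantorovich_potential ::
    "'a::euclidean_space set \<Rightarrow> 'a measure \<Rightarrow> 'a measure \<Rightarrow> ('a \<Rightarrow> real) \<Rightarrow> bool" where
  "kantorovich_potential \<Omega> \<mu> \<nu> u \<longleftrightarrow>
     1-lipschitz_on \<Omega> u \<and>
     (\<forall>v. 1-lipschitz_on \<Omega> v \<longrightarrow>
        (LINT x:\<Omega>|\<mu>. v x) - (LINT x:\<Omega>|\<nu>. v x) \<le> (LINT x:\<Omega>|\<mu>. u x) - (LINT x:\<Omega>|\<nu>. u x))"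

text \<open>
  Maps from \<open>\<Omega>\<close> to \<open>\<Omega>\<close>, Borel measurable so that the pushforward is defined; values outside
  \<open>\<Omega>\<close> are irrelevant, which is why the pushforward is taken of \<open>\<mu>\<close> restricted to \<open>\<Omega>\<close>.
\<close>

definition transport_maps ::
    "'a::euclidean_space set \<Rightarrow> 'a measure \<Rightarrow> 'a measure \<Rightarrow> ('a \<Rightarrow> 'a) set" where
  "transport_maps \<Omega> \<mu> \<nu> =
     {T \<in> restrict_space borel \<Omega> \<rightarrow>\<^sub>M restrict_space borel \<Omega>.
        distr (restrict_space \<mu> \<Omega>) borel T = \<nu>}"

definition optimal_transport_map ::
    "'a::euclidean_space set \<Rightarrow> 'a measure \<Rightarrow> 'a measure \<Rightarrow> ('a \<Rightarrow> 'a) \<Rightarrow> bool" where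
  "optimal_transport_map \<Omega> \<mu> \<nu> T\<^sub>0 \<longleftrightarrow>
     T\<^sub>0 \<in> transport_maps \<Omega> \<mu> \<nu> \<and>
     (\<forall>T \<in> transport_maps \<Omega> \<mu> \<nu>.
        (LINT x:\<Omega>|\<mu>. norm (x - T\<^sub>0 x)) \<le> (LINT x:\<Omega>|\<mu>. norm (x - T x)))"

definition min_displacement ::
    "'a::euclidean_space set \<Rightarrow> 'a measure \<Rightarrow> ('a \<Rightarrow> 'a) \<Rightarrow> real" where
  "min_displacement \<Omega> \<mu> T = Sup {l::real. emeasure \<mu> {x \<in> \<Omega>. norm (x - T x) < l} = 0}"

text \<open>
  For a function on \<open>\<Omega>\<close>, existence of the gradient is understood at interior points of \<open>\<Omega>\<close>.
  At such points it does not depend on the values of \<open>u\<close> outside \<open>\<Omega>\<close>.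
\<close>

definition descent_step :: "'a::euclidean_space set \<Rightarrow> real \<Rightarrow> ('a \<Rightarrow> real) \<Rightarrow> 'a \<Rightarrow> 'a" where
  "descent_step \<Omega> \<eta> u x =
     (if x \<in> interior \<Omega> \<and> (\<exists>D. GDERIV u x :> D)
      then x - \<eta> *\<^sub>R (THE D. GDERIV u x :> D)
      else x)"

primrec descent_measure ::
    "'a::euclidean_space set \<Rightarrow> real \<Rightarrow> 'a measure \<Rightarrow> (nat \<Rightarrow> 'a \<Rightarrow> real) \<Rightarrow> 'a measure \<Rightarrow> nat \<Rightarrow> 'a measure"
where
  "descent_measure \<Omega> \<theta> \<nu> u \<mu> 0 = \<mu>"
| "descent_measure \<Omega> \<theta> \<nu> u \<mu> (Suc n) =
     distr (descent_measure \<Omega> \<theta> \<nu> u \<mu> n) borel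
       (descent_step \<Omega> (\<theta> * W1 \<Omega> (descent_measure \<Omega> \<theta> \<nu> u \<mu> n) \<nu>) (u n))"

text \<open>
  The last index, for minimal displacement \<open>l\<close> and initial distance \<open>w\<close>. The case \<open>l = w\<close> encodes
  the convention that the logarithm of 0 to a base in \<open>(0, 1)\<close> is \<open>\<infinity>\<close> (the library logarithm
  of 0 is 0). Otherwise the value is an integer, possibly \<open>-1\<close>.
\<close>

definition last_index :: "real \<Rightarrow> real \<Rightarrow> real \<Rightarrow> ereal" where
  "last_index \<theta> l w =
     (if l = w then \<infinity> else ereal (of_int (\<lceil>log (1 - \<theta>) (1 - l / w)\<rceil> - 1)))"

end

theory Submission
  imports Defs
begin

text \<open>
  Permuting small sets of equal mass shows that an optimal map \<open>T\<close> is cyclically monotone, so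
  there is a 1-Lipschitz \<open>v\<close> with \<open>v x - v (T x) = \<bar>x - T x\<bar>\<close> almost everywhere; in particular the
  Monge cost, \<open>W\<^sub>1\<close> and the dual value agree. Moving every point by the same length \<open>a\<close> less than the minimal
  displacement towards \<open>T x\<close> keeps \<open>v\<close> a potential, lowers \<open>W\<^sub>1\<close> by exactly \<open>a\<close>, and preserves
  absolute continuity, because the motion is undone by \<open>y \<mapsto> y + a \<nabla>v(y)\<close>, which is Lipschitz on
  points whose ray extends a fixed length to both sides. Any other potential \<open>w\<close> of the moved measure has
  slope 1 from \<open>T x\<close> to the moved point, and upper ends of rays form a null set; so almost every
  moved point lies inside a ray of \<open>w\<close>, where \<open>\<nabla>w\<close> exists and points away from \<open>T x\<close>. Hence every
  step moves mass along the original segments by \<open>\<theta>\<close> times the current distance.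
\<close>

section \<open>Transport of atomless measures\<close>

text \<open>The potentials chosen along the iteration are arbitrary and may differ from
  \<open>v\<close> and from each other, so the directions of the steps must be recovered from
  \<open>T\<close>. Rays that extend to both sides of a point give differentiability and the value
  of the gradient at once, without Rademacher's theorem. The range of n comes from a geometric sum:
  n steps of length \<theta> (1 - \<theta>)^k W1 move mass by (1 - (1 - \<theta>)^n) W1, and
  N(\<theta>) is the last n for which this stays below the minimal displacement. As long as it does,
  every moved point keeps a uniform length of ray below it. Only the motion back up is Lipschitz:
  the starting point may be the top of its ray, where nothing controls the direction. Permuting sets
  of equal mass needs measure-preserving maps between them. They come from quantile functions on the
  line, carried to the Euclidean space by a Borel encoding.\<close>

definition ternary_code :: "(nat \<Rightarrow> bool) \<Rightarrow> real" where
  "ternary_code c = (\<Sum>n. of_bool (c n) / 3 ^ Suc n)"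

text \<open>On codes this is the left shift of the digit sequence; being a Borel function of a real
  number, it makes every digit Borel in the code.\<close>

definition ternary_shift :: "real \<Rightarrow> real" where
  "ternary_shift z = 3 * z - of_bool (z \<ge> 1 / 3)"

lemma summable_ternary: "summable (\<lambda>n. of_bool (c n) / (3::real) ^ Suc n)"
proof (rule summable_comparison_test')
  show "summable (\<lambda>n. (1 / 3) * (1 / 3 :: real) ^ n)"
    by (intro summable_mult summable_geometric) simp
qed (auto simp: field_simps power_divide)

lemma ternary_code_bounds: "0 \<le> ternary_code c" "ternary_code c \<le> 1 / 2"
proof -
  show "0 \<le> ternary_code c"
    unfolding ternary_code_def by (intro suminf_nonneg summable_ternary) simp
  have "ternary_code c \<le> (\<Sum>n. (1 / 3) * (1 / 3 :: real) ^ n)"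
    unfolding ternary_code_def
    by (intro suminf_le summable_ternary summable_mult summable_geometric)
       (auto simp: field_simps power_divide)
  also have "\<dots> = 1 / 2"
    by (subst suminf_mult) (auto simp: suminf_geometric)
  finally show "ternary_code c \<le> 1 / 2" .
qed

lemma ternary_code_rec: "ternary_code c = (of_bool (c 0) + ternary_code (\<lambda>n. c (Suc n))) / 3"
proof -
  have "ternary_code c = of_bool (c 0) / 3 + (\<Sum>n. of_bool (c (Suc n)) / 3 ^ Suc (Suc n))"
    unfolding ternary_code_def using suminf_split_head[OF summable_ternary[of c]] by simp
  also have "(\<Sum>n. of_bool (c (Suc n)) / (3::real) ^ Suc (Suc n)) =
      (\<Sum>n. (1 / 3) * (of_bool (c (Suc n)) / 3 ^ Suc n))"
    by (intro suminf_cong) simp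
  also have "\<dots> = ternary_code (\<lambda>n. c (Suc n)) / 3"
    unfolding ternary_code_def by (subst suminf_mult[OF summable_ternary]) simp
  finally show ?thesis by (simp add: add_divide_distrib)
qed

text \<open>Digits 0 and 1 in base 3 avoid the double expansions of base 2: if the first digit is 0,
  the rest contributes at most 1/6, so comparison with 1/3 reads the digit.\<close>

lemma ternary_code_first: "ternary_code c \<ge> 1 / 3 \<longleftrightarrow> c 0"
proof -
  define t where "t = ternary_code (\<lambda>n. c (Suc n))"
  have "ternary_code c = (of_bool (c 0) + t) / 3" "0 \<le> t" "t \<le> 1 / 2"
    using ternary_code_rec[of c] ternary_code_bounds[of "\<lambda>n. c (Suc n)"] by (auto simp: t_def)
  then show ?thesis by (cases "c 0") auto
qed

lemma ternary_digit: "(ternary_shift ^^ n) (ternary_code c) \<ge> 1 / 3 \<longleftrightarrow> c n"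
proof (induction n arbitrary: c)
  case 0
  then show ?case using ternary_code_first[of c] by simp
next
  case (Suc n)
  have "ternary_shift (ternary_code c) = ternary_code (\<lambda>n. c (Suc n))"
    unfolding ternary_shift_def ternary_code_first
    using ternary_code_rec[of c] by simp
  then show ?case
    using Suc[of "\<lambda>n. c (Suc n)"] by (simp only: funpow_Suc_right o_apply)
qed

lemma ternary_shift_measurable [measurable]: "ternary_shift \<in> borel_measurable borel"
  unfolding ternary_shift_def by measurable

lemma ternary_shift_power_measurable [measurable]:
  "(ternary_shift ^^ n) \<in> borel_measurable borel"
  by (induction n) (auto simp: measurable_comp)

text \<open>Decoding: a coordinate is the supremum of the rationals below it. In the extended reals
  this supremum is Borel in the code without any boundedness condition.\<close>

lemma SUP_rational_below:
  fixes r :: real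
  assumes "range f = \<rat>"
  shows "(SUP n. if ereal (f n) < ereal r then ereal (f n) else - \<infinity>) = ereal r"
proof (rule antisym)
  show "(SUP n. if ereal (f n) < ereal r then ereal (f n) else - \<infinity>) \<le> ereal r"
    by (intro SUP_least) auto
  show "ereal r \<le> (SUP n. if ereal (f n) < ereal r then ereal (f n) else - \<infinity>)"
  proof (rule dense_le)
    fix y assume "y < ereal r"
    then obtain s where s: "y < ereal s" "s < r"
      using ereal_dense2 by fastforce
    obtain q where q: "q \<in> \<rat>" "s < q" "q < r"
      using Rats_dense_in_real[OF s(2)] by blast
    then obtain n where "f n = q" using assms by (metis rangeE)
    with q have "ereal q \<le> (SUP n. if ereal (f n) < ereal r then ereal (f n) else - \<infinity>)"
      by (intro SUP_upper2[of n]) auto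
    with s q show "y \<le> (SUP n. if ereal (f n) < ereal r then ereal (f n) else - \<infinity>)"
      by (meson ereal_less_eq(3) less_imp_le order_trans)
  qed
qed

text \<open>
  A point is determined by the rational half-spaces containing it; these countably many bits are
  stored as ternary digits 0 and 1 of a real number.
\<close>

lemma Borel_encoding:
  obtains e :: "'a::euclidean_space \<Rightarrow> real" and d :: "real \<Rightarrow> 'a"
  where "e \<in> borel_measurable borel" "d \<in> borel_measurable borel" "\<And>x. d (e x) = x"
proof -
  define q :: "nat \<Rightarrow> real" where "q = from_nat_into \<rat>"
  have q: "range q = \<rat>"
    unfolding q_def by (intro range_from_nat_into) (auto simp: countable_rat)
  define B :: "nat \<Rightarrow> 'a" where "B = from_nat_into Basis"
  have B: "range B = Basis"
    unfolding B_def by (intro range_from_nat_into) (auto simp: countable_finite)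
  define bit where "bit x n = (let (i, j) = prod_decode n in q j < x \<bullet> B i)" for x n
  define e where "e x = ternary_code (bit x)" for x
  define D where "D i z = (SUP j. if (ternary_shift ^^ prod_encode (i, j)) z \<ge> 1 / 3
      then ereal (q j) else - \<infinity>)" for i z
  \<comment> \<open>\<open>B\<close> enumerates the finite basis with repetitions, so one index of
    each basis vector has to be picked.\<close>
  define d where "d z = (\<Sum>b\<in>Basis. real_of_ereal (D (SOME i. B i = b) z) *\<^sub>R b)" for z
  have [measurable]: "D i \<in> borel_measurable borel" for i
    unfolding D_def by measurable
  have d: "d \<in> borel_measurable borel"
    unfolding d_def by measurable
  have [measurable]: "Measurable.pred borel (\<lambda>x. bit x n)" for n
    unfolding bit_def by (cases "prod_decode n") (auto simp: pred_def)
  have e: "e \<in> borel_measurable borel"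
    unfolding e_def ternary_code_def by measurable
  have De: "D i (e x) = ereal (x \<bullet> B i)" for i x
    using SUP_rational_below[OF q, of "x \<bullet> B i"] unfolding D_def e_def ternary_digit
    by (simp add: bit_def)
  have "B (SOME i. B i = b) = b" if "b \<in> Basis" for b
    using that B by (metis (mono_tags, lifting) imageE someI_ex)
  then have "d (e x) = x" for x
    unfolding d_def De by (simp add: euclidean_representation)
  with d e that show thesis by blast
qed

section \<open>Quantile transport on the real line\<close>

lemma (in cdf_distribution) prob_cdf_less:
  assumes atomless: "\<And>x. measure M {x} = 0" and s: "0 < s" "s < 1"
  shows "measure M {x. C x < s} = s"
proof -
  have eq: "{x. C x < s} = {..<I s}"
  proof -
    have "C x < s \<longleftrightarrow> x < I s" for x
      using pseudoinverse[OF s, of x] by linarith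
    then show ?thesis by blast
  qed
  have "C y = measure M {..<y}" for y
    unfolding cdf_def ivl_disj_un(2)[symmetric] using atomless[of y]
    by (subst finite_measure_Union) auto
  then have "C (I s) = measure M {..<I s}" .
  moreover have "C (I s) \<ge> s"
    using pseudoinverse[OF s, of "I s"] by blast
  \<comment> \<open>Without atoms the cdf is continuous, so its value at \<open>I s\<close> is the
    limit of values from the left, all of them below s.\<close>
  moreover have "C (I s) \<le> s"
  proof (rule tendsto_upperbound)
    show "(C \<longlongrightarrow> C (I s)) (at_left (I s))"
      using isCont_cdf[of "I s"] atomless unfolding isCont_def
      by (intro tendsto_mono[OF at_le[of "{..<I s}" UNIV]]) auto
    show "\<forall>\<^sub>F x in at_left (I s). C x \<le> s"
      using eq by (auto simp: eventually_at_filter intro!: always_eventually less_imp_le)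
  qed simp
  ultimately show ?thesis by (simp add: eq)
qed

text \<open>The cdf of an atomless law is uniformly distributed; closed level sets are squeezed
  between the open ones of nearby levels.\<close>

lemma (in cdf_distribution) prob_cdf_le:
  assumes atomless: "\<And>x. measure M {x} = 0" and s: "0 \<le> s" "s \<le> 1"
  shows "measure M {x. C x \<le> s} = s"
proof (rule antisym)
  have [measurable]: "{x. C x \<le> t} \<in> sets borel" "{x. C x < t} \<in> sets borel" for t
    using borel_measurable_le[OF measurable_C, of "\<lambda>_. t"] borel_measurable_less[OF measurable_C, of "\<lambda>_. t"]
    by simp_all
  show "measure M {x. C x \<le> s} \<le> s"
  proof (cases "s = 1")
    case False
    show ?thesis
    proof (rule dense_ge_bounded)
      show "s < 1" using False s by simp
      fix t assume "s < t" "t < 1"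
      then have "measure M {x. C x \<le> s} \<le> measure M {x. C x < t}"
        by (intro finite_measure_mono) auto
      also have "\<dots> = t" using \<open>s < t\<close> \<open>t < 1\<close> s by (intro prob_cdf_less atomless) auto
      finally show "measure M {x. C x \<le> s} \<le> t" .
    qed
  qed simp
  show "s \<le> measure M {x. C x \<le> s}"
  proof (cases "s = 0")
    case False
    show ?thesis
    proof (rule dense_le_bounded)
      show "0 < s" using False s by simp
      fix t assume t: "0 < t" "t < s"
      then have "t = measure M {x. C x < t}"
        using s by (intro prob_cdf_less[symmetric] atomless) auto
      also have "\<dots> \<le> measure M {x. C x \<le> s}"
        using t by (intro finite_measure_mono) auto
      finally show "t \<le> measure M {x. C x \<le> s}" .
    qed
  qed simp
qed

text \<open>The cdf of \<open>M\<close> turns \<open>M\<close> into the uniform law, and the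
  quantile function of \<open>K\<close> turns the uniform law into \<open>K\<close>.\<close>

lemma real_transport_exists:
  assumes M: "real_distribution M" and K: "real_distribution K"
    and atomless: "\<And>x. measure M {x} = 0"
  obtains f where "f \<in> borel_measurable borel" "distr M borel f = K"
proof -
  interpret M: cdf_distribution M unfolding cdf_distribution_def by (rule M)
  interpret K: cdf_distribution K unfolding cdf_distribution_def by (rule K)
  \<comment> \<open>The quantile function is controlled only on the open unit interval;
    \<open>ae\<close> below places the cdf of \<open>M\<close> there almost everywhere.\<close>
  define g where "g w = indicator {0<..<1::real} w *\<^sub>R K.I w" for w
  have [measurable]: "g \<in> borel_measurable borel"
  proof -
    have "(\<lambda>w. indicator {0<..<1::real} w *\<^sub>R K.I w) \<in> borel_measurable borel"
      by (subst borel_measurable_restrict_space_iff[symmetric]) (simp, rule K.measurable_CI)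
    then show ?thesis unfolding g_def .
  qed
  let ?f = "\<lambda>x. g (M.C x)"
  have f: "?f \<in> borel_measurable borel"
    by measurable
  then have fM [measurable]: "?f \<in> borel_measurable M" by simp
  interpret D: prob_space "distr M borel ?f"
    by (rule M.prob_space_distr) measurable
  have [measurable]: "{x. M.C x \<le> t} \<in> sets borel" for t
    using borel_measurable_le[OF M.measurable_C, of "\<lambda>_. t"] by simp
  have "AE x in M. \<not> M.C x \<le> 0"
  proof -
    have "measure M {x. M.C x \<le> 0} = 0" using M.prob_cdf_le[OF atomless, of 0] by simp
    then show ?thesis
      by (intro AE_I[where N="{x. M.C x \<le> 0}"]) (auto simp: M.emeasure_eq_measure)
  qed
  moreover have "AE x in M. M.C x < 1"
  proof -
    have "measure M (space M - {x. M.C x < 1}) \<le> 0"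
    proof (rule field_le_epsilon)
      fix e :: real assume "e > 0"
      \<comment> \<open>The maximum with 1/2 keeps s positive when e is at least 1; in every case 1
        - s is at most e.\<close>
      define s where "s = max (1 / 2) (1 - e)"
      have s: "0 < s" "s < 1" using \<open>e > 0\<close> by (auto simp: s_def)
      have "measure M (space M - {x. M.C x < 1}) \<le> measure M (space M - {x. M.C x \<le> s})"
        using s by (intro M.finite_measure_mono) auto
      also have "\<dots> = 1 - s" 
        using M.prob_compl[of "{x. M.C x \<le> s}"] M.prob_cdf_le[OF atomless, of s] s by simp
      also have "\<dots> \<le> 0 + e" by (auto simp: s_def)
      finally show "measure M (space M - {x. M.C x < 1}) \<le> 0 + e" .
    qed
    then have "measure M (space M - {x. M.C x < 1}) = 0"
      by (simp add: measure_le_0_iff)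
    moreover have "{x. M.C x < 1} \<in> sets borel"
      using borel_measurable_less[OF M.measurable_C, of "\<lambda>_. 1"] by simp
    ultimately show ?thesis
      by (intro AE_I[where N="space M - {x. M.C x < 1}"]) (auto simp: M.emeasure_eq_measure)
  qed
  ultimately have ae: "AE x in M. 0 < M.C x \<and> M.C x < 1"
    by eventually_elim auto
  have "distr M borel ?f = K"
  proof (rule cdf_unique[OF _ K], goal_cases)
    case 1
    show ?case by (auto simp: real_distribution_def real_distribution_axioms_def D.prob_space_axioms)
  next
    case 2
    show ?case
    proof
      fix t
      have "cdf (distr M borel ?f) t = measure M {x. ?f x \<le> t}"
        unfolding cdf_def[of "distr M borel ?f"] by (subst measure_distr[OF fM]) (auto simp: vimage_def)
      also have "\<dots> = measure M {x. M.C x \<le> K.C t}"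
      proof (rule M.finite_measure_eq_AE)
        show "AE x in M. (x \<in> {x. ?f x \<le> t}) = (x \<in> {x. M.C x \<le> K.C t})"
          using ae
        proof eventually_elim
          case (elim x)
          then have "M.C x \<le> K.C t \<longleftrightarrow> K.I (M.C x) \<le> t"
            by (intro K.pseudoinverse) auto
          with elim show ?case by (simp add: g_def del: Collect_mono_iff)
        qed
        show "{x. ?f x \<le> t} \<in> sets M"
          using borel_measurable_le[OF f, of "\<lambda>_. t"] by simp
      qed simp
      also have "\<dots> = K.C t"
        using K.cdf_bounded_prob[of t] by (intro M.prob_cdf_le atomless) (auto simp: K.cdf_nonneg)
      finally show "cdf (distr M borel ?f) t = cdf K t" .
    qed
  qed
  with f that show thesis by blast
qed

text \<open>Injectivity of the encoding keeps the image of \<open>M\<close> free of atoms, so the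
  one-dimensional transport applies to the encoded measures, and decoding brings it back.\<close>

lemma transport_exists:
  fixes M K :: "'a::euclidean_space measure"
  assumes M: "prob_space M" "sets M = sets borel" and K: "prob_space K" "sets K = sets borel"
    and atomless: "\<And>x. measure M {x} = 0"
  obtains f where "f \<in> borel_measurable borel" "distr M borel f = K"
proof -
  interpret M: prob_space M by fact
  interpret K: prob_space K by fact
  note [measurable_cong] = M(2) K(2)
  obtain e :: "'a \<Rightarrow> real" and d where [measurable]: "e \<in> borel_measurable borel" "d \<in> borel_measurable borel"
    and de: "\<And>x. d (e x) = x" using Borel_encoding by blast
  have sp: "space M = UNIV" using sets_eq_imp_space_eq[OF M(2)] by simp
  have "real_distribution (distr M borel e)" "real_distribution (distr K borel e)"
    by (auto simp: real_distribution_def real_distribution_axioms_def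
        intro!: M.prob_space_distr K.prob_space_distr)
  moreover have "measure (distr M borel e) {t} = 0" for t
  proof -
    have "measure (distr M borel e) {t} = measure M (e -` {t} \<inter> space M)"
      by (rule measure_distr) measurable
    also have "\<dots> \<le> measure M {d t}"
      using M(2) by (intro M.finite_measure_mono) (auto simp: de[symmetric])
    finally show ?thesis by (simp add: atomless measure_le_0_iff)
  qed
  ultimately obtain f where [measurable]: "f \<in> borel_measurable borel"
    and f: "distr (distr M borel e) borel f = distr K borel e"
    by (rule real_transport_exists)
  have "distr M borel (\<lambda>x. d (f (e x))) = distr (distr (distr M borel e) borel f) borel d"
    by (simp add: distr_distr comp_def)
  also have "\<dots> = distr K borel (\<lambda>x. d (e x))"
    unfolding f by (simp add: distr_distr comp_def)
  also have "\<dots> = K" unfolding de using K(2) by (simp add: distr_id2)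
  finally show thesis by (intro that[of "\<lambda>x. d (f (e x))"]) simp_all
qed

section \<open>Splitting and permuting an atomless measure\<close>

locale atomless_prob = prob_space M for M :: "'a::euclidean_space measure" +
  assumes sets_eq [measurable_cong, simp]: "sets M = sets borel"
    and atomless: "measure M {x} = 0"
begin

lemma space_eq [simp]: "space M = UNIV"
  using sets_eq_imp_space_eq[OF sets_eq] by simp

lemma prob_space_uniform:
  assumes "A \<in> sets borel" "0 < measure M A"
  shows "prob_space (uniform_measure M A)"
  using assms by (intro prob_space_uniform_measure) (auto simp: emeasure_eq_measure)

lemma measure_uniform:
  assumes "A \<in> sets borel" "0 < measure M A" "E \<in> sets borel"
  shows "measure (uniform_measure M A) E = measure M (A \<inter> E) / measure M A"
  using assms by (intro measure_uniform_measure) (auto simp: emeasure_eq_measure)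

lemma transport_from_set:
  fixes K :: "'a measure"
  assumes A: "A \<in> sets borel" "0 < measure M A" and K: "prob_space K" "sets K = sets borel"
  obtains f where "f \<in> borel_measurable borel"
    "\<And>E. E \<in> sets borel \<Longrightarrow> measure M (A \<inter> f -` E) = measure M A * measure K E"
proof -
  interpret U: prob_space "uniform_measure M A" by (rule prob_space_uniform[OF A])
  have "measure (uniform_measure M A) {x} = 0" for x
  proof -
    have "measure M (A \<inter> {x}) \<le> measure M {x}"
      using A by (intro finite_measure_mono) auto
    then show ?thesis
      using A by (simp add: measure_uniform atomless measure_le_0_iff)
  qed
  then obtain f where f [measurable]: "f \<in> borel_measurable borel"
    and K': "distr (uniform_measure M A) borel f = K"
    using transport_exists[OF U.prob_space_axioms _ K] by auto
  have "measure M (A \<inter> f -` E) = measure M A * measure K E" if E: "E \<in> sets borel" for E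
  proof -
    have "measure K E = measure (uniform_measure M A) (f -` E)"
      using E by (subst K'[symmetric], subst measure_distr) auto
    also have "\<dots> = measure M (A \<inter> f -` E) / measure M A"
      using measurable_sets[OF f E] by (intro measure_uniform A) simp
    finally show ?thesis using A by simp
  qed
  with f that show thesis by blast
qed

text \<open>Transport of the normalised restrictions reaches \<open>B\<close> only up to a null set.
  Sending the exceptional points to a fixed \<open>b\<close> in \<open>B\<close> makes the inclusion
  exact, as the pointwise cost estimate for permuted pieces requires.\<close>

lemma transport_between_sets:
  assumes A: "A \<in> sets borel" and B: "B \<in> sets borel"
    and eq: "measure M A = measure M B" and pos: "0 < measure M A"
  obtains f where "f \<in> borel_measurable borel" "f \<in> A \<rightarrow> B"
    "\<And>E. E \<in> sets borel \<Longrightarrow> measure M (A \<inter> f -` E) = measure M (B \<inter> E)"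
proof -
  obtain b where b: "b \<in> B"
    using eq pos by fastforce
  obtain g where g [measurable]: "g \<in> borel_measurable borel"
    and gE: "\<And>E. E \<in> sets borel \<Longrightarrow> measure M (A \<inter> g -` E) = measure M A * measure (uniform_measure M B) E"
    using transport_from_set[OF A pos prob_space_uniform[of B]] B eq pos by auto
  have gE': "measure M (A \<inter> g -` E) = measure M (B \<inter> E)" if "E \<in> sets borel" for E
    using gE[OF that] that B eq pos by (simp add: measure_uniform)
  note B [measurable] A [measurable]
  define f where "f x = (if g x \<in> B then g x else b)" for x
  have f: "f \<in> borel_measurable borel" unfolding f_def by measurable
  have "measure M (A \<inter> f -` E) = measure M (B \<inter> E)" if E [measurable]: "E \<in> sets borel" for E
  proof -
    have m: "g -` B' \<in> sets borel" "f -` B' \<in> sets borel" if "B' \<in> sets borel" for B'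
      using measurable_sets[OF g that] measurable_sets[OF f that] by auto
    have "measure M (A \<inter> g -` (- B)) = 0"
      by (subst gE') auto
    then have "A \<inter> g -` (- B) \<in> null_sets M"
      using m(1)[of "- B"] A B by (intro null_setsI) (auto simp: emeasure_eq_measure)
    then have "AE x in M. x \<notin> A \<inter> g -` (- B)" by (rule AE_not_in)
    then have "measure M (A \<inter> f -` E) = measure M (A \<inter> g -` E)"
      by (intro finite_measure_eq_AE) (use m E in \<open>auto simp: f_def\<close>)
    then show ?thesis using gE' E by simp
  qed
  with f b that[of f] show thesis by (auto simp: f_def)
qed

text \<open>Transport \<open>A\<close> onto a law with two atoms, one of relative weight t, and keep
  the preimage of that atom; \<open>One\<close> is just a point different from 0.\<close>

lemma subset_of_measure:
  assumes A: "A \<in> sets borel" and t: "0 \<le> t" "t \<le> measure M A"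
  obtains B where "B \<in> sets borel" "B \<subseteq> A" "measure M B = t"
proof (cases "measure M A = 0")
  case True
  then show thesis using that[of "{}"] t by simp
next
  case False
  then have pos: "0 < measure M A" by (simp add: zero_less_measure_iff)
  define K where "K = distr (measure_pmf (bernoulli_pmf (t / measure M A))) borel
    (\<lambda>b. if b then 0 else One :: 'a)"
  have K: "prob_space K" "sets K = sets borel"
    unfolding K_def by (auto intro!: measure_pmf.prob_space_distr)
  have "(\<lambda>b. if b then 0 else One :: 'a) -` {0} = {True}" by (auto split: if_splits)
  then have "measure K {0} = t / measure M A"
    unfolding K_def using t pos by (subst measure_distr) (auto simp: measure_pmf_single)
  moreover obtain f where f: "f \<in> borel_measurable borel"
    and "\<And>E. E \<in> sets borel \<Longrightarrow> measure M (A \<inter> f -` E) = measure M A * measure K E"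
    using transport_from_set[OF A pos K] by auto
  ultimately have "measure M (A \<inter> f -` {0}) = t" using pos by simp
  moreover have "A \<inter> f -` {0} \<in> sets borel"
    using A measurable_sets[OF f, of "{0}"] by auto
  ultimately show thesis using that by auto
qed

text \<open>The factor k leaves room for a greedy choice: at most k - 1 sets of mass m are removed
  before the next one is picked. The given sets may overlap or coincide, as happens when a cycle
  visits a point twice.\<close>

lemma disjoint_subsets_of_measure:
  fixes k :: nat and m :: real
  assumes A: "\<And>i. i < k \<Longrightarrow> A i \<in> sets borel" "\<And>i. i < k \<Longrightarrow> k * m \<le> measure M (A i)" and m: "0 \<le> m"
  obtains B where "\<And>i. i < k \<Longrightarrow> B i \<in> sets borel" "\<And>i. i < k \<Longrightarrow> B i \<subseteq> A i"
    "\<And>i. i < k \<Longrightarrow> measure M (B i) = m" "disjoint_family_on B {..<k}"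
proof -
  have "\<exists>B. (\<forall>i<n. B i \<in> sets borel \<and> B i \<subseteq> A i \<and> measure M (B i) = m) \<and> disjoint_family_on B {..<n}"
    if "n \<le> k" for n
    using that
  proof (induction n)
    case 0
    then show ?case by (simp add: disjoint_family_on_def)
  next
    case (Suc n)
    then obtain B where B: "\<And>i. i < n \<Longrightarrow> B i \<in> sets borel \<and> B i \<subseteq> A i \<and> measure M (B i) = m"
      and disj: "disjoint_family_on B {..<n}" by auto
    let ?U = "\<Union>i<n. B i"
    have U: "?U \<in> sets borel" using B by auto
    have "measure M ?U \<le> (\<Sum>i<n. measure M (B i))"
      using B by (intro finite_measure_subadditive_finite) auto
    also have "\<dots> = n * m" using B by simp
    finally have "measure M ?U \<le> n * m" .
    moreover have "real k * m \<le> measure M (A n)" using A(2)[of n] Suc by simp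
    moreover have "real n * m + m \<le> real k * m"
      using Suc.prems m mult_right_mono[of "real n + 1" "real k" m] by (simp add: algebra_simps)
    moreover have "measure M (A n) \<le> measure M (A n - ?U) + measure M ?U"
    proof -
      have "measure M (A n) \<le> measure M ((A n - ?U) \<union> ?U)"
        using A(1)[of n] U Suc.prems by (intro finite_measure_mono) auto
      also have "\<dots> \<le> measure M (A n - ?U) + measure M ?U"
        using A(1)[of n] U Suc.prems by (intro measure_Un_le) auto
      finally show ?thesis .
    qed
    ultimately have "m \<le> measure M (A n - ?U)" by linarith
    then obtain C where C: "C \<in> sets borel" "C \<subseteq> A n - ?U" "measure M C = m"
      using subset_of_measure[of "A n - ?U" m] A(1)[of n] U Suc.prems m by auto
    have "disjoint_family_on (B(n := C)) {..<Suc n}"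
      using disj C(2) unfolding disjoint_family_on_def
      by (auto simp: less_Suc_eq split: if_splits) (metis IntI empty_iff lessThan_iff)+
    then show ?case
      using B C by (intro exI[of _ "B(n := C)"] conjI) (simp add: less_Suc_eq, blast, simp only:)
  qed
  from this[OF order_refl] that show thesis by blast
qed

text \<open>\<open>\<sigma>\<close> need not be injective: the competitor of \<open>T\<close> is
  \<open>T\<close> after \<open>\<sigma>\<close>, and it has the same image measure as soon as
  \<open>\<sigma>\<close> preserves \<open>M\<close>.\<close>

lemma measure_preserving_permutation:
  fixes k :: nat and m :: real
  assumes B: "\<And>i. i < k \<Longrightarrow> B i \<in> sets borel" and mB: "\<And>i. i < k \<Longrightarrow> measure M (B i) = m"
    and m: "0 < m" and disj: "disjoint_family_on B {..<k}" and \<pi>: "bij_betw \<pi> {..<k} {..<k}"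
  obtains \<sigma> where "\<sigma> \<in> borel_measurable borel" "distr M borel \<sigma> = M"
    "\<And>i x. i < k \<Longrightarrow> x \<in> B i \<Longrightarrow> \<sigma> x \<in> B (\<pi> i)" "\<And>x. x \<notin> (\<Union>i<k. B i) \<Longrightarrow> \<sigma> x = x"
proof -
  have \<pi>k: "\<pi> i < k" if "i < k" for i using \<pi> that unfolding bij_betw_def by blast
  have "\<exists>f. f \<in> borel_measurable borel \<and> f \<in> B i \<rightarrow> B (\<pi> i) \<and>
      (\<forall>E \<in> sets borel. measure M (B i \<inter> f -` E) = measure M (B (\<pi> i) \<inter> E))" if "i < k" for i
    using transport_between_sets[of "B i" "B (\<pi> i)"] B mB m \<pi>k that by metis
  then obtain f where f: "\<And>i. i < k \<Longrightarrow> f i \<in> borel_measurable borel"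
    "\<And>i. i < k \<Longrightarrow> f i \<in> B i \<rightarrow> B (\<pi> i)"
    "\<And>i E. i < k \<Longrightarrow> E \<in> sets borel \<Longrightarrow> measure M (B i \<inter> f i -` E) = measure M (B (\<pi> i) \<inter> E)"
    by metis
  let ?U = "\<Union>i<k. B i"
  define \<sigma> where "\<sigma> x = (if x \<in> ?U then f (SOME i. i < k \<and> x \<in> B i) x else x)" for x
  have \<sigma>: "\<sigma> x = f i x" if "i < k" "x \<in> B i" for i x
  proof -
    have "(SOME i. i < k \<and> x \<in> B i) = i"
      using that disj unfolding disjoint_family_on_def by (intro some_equality) auto
    then show ?thesis using that by (auto simp: \<sigma>_def)
  qed
  have U [measurable]: "?U \<in> sets borel" using B by auto
  have pre: "\<sigma> -` E = (\<Union>i<k. B i \<inter> f i -` E) \<union> (E - ?U)" for E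
  proof (rule set_eqI)
    fix x
    show "x \<in> \<sigma> -` E \<longleftrightarrow> x \<in> (\<Union>i<k. B i \<inter> f i -` E) \<union> (E - ?U)"
    proof (cases "x \<in> ?U")
      case True
      then obtain i where i: "i < k" "x \<in> B i" by auto
      have "j = i" if "j < k" "x \<in> B j" for j
        using that i disj unfolding disjoint_family_on_def by (metis IntI empty_iff lessThan_iff)
      then have "(\<exists>j<k. x \<in> B j \<and> f j x \<in> E) \<longleftrightarrow> f i x \<in> E"
        using i by metis
      then show ?thesis using True \<sigma>[OF i] by (simp add: Bex_def)
    qed (auto simp: \<sigma>_def)
  qed
  have mf: "B i \<inter> f i -` E \<in> sets borel" if "i < k" "E \<in> sets borel" for i E
    using B[OF that(1)] measurable_sets[OF f(1)[OF that(1)] that(2)] by auto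
  have \<sigma>m: "\<sigma> \<in> borel_measurable borel"
  proof (rule measurableI)
    fix E :: "'a set" assume E: "E \<in> sets borel"
    have "(\<Union>i<k. B i \<inter> f i -` E) \<in> sets borel"
      by (rule sets.finite_UN) (simp_all add: mf E)
    then have "\<sigma> -` E \<in> sets borel"
      unfolding pre using U E by (intro sets.Un sets.Diff)
    then show "\<sigma> -` E \<inter> space borel \<in> sets borel" by simp
  qed simp
  have "distr M borel \<sigma> = M"
  proof (rule measure_eqI)
    fix E assume "E \<in> sets (distr M borel \<sigma>)"
    then have E [measurable]: "E \<in> sets borel" by simp
    have dB: "disjoint_family_on (\<lambda>i. B i \<inter> C i) {..<k}" for C
      using disj unfolding disjoint_family_on_def by auto
    have "measure M (\<sigma> -` E) = measure M (\<Union>i<k. B i \<inter> f i -` E) + measure M (E - ?U)"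
      unfolding pre using mf E by (intro finite_measure_Union) auto
    also have "measure M (\<Union>i<k. B i \<inter> f i -` E) = (\<Sum>i<k. measure M (B i \<inter> f i -` E))"
      using mf E by (intro finite_measure_finite_Union dB) auto
    also have "\<dots> = (\<Sum>i<k. measure M (B (\<pi> i) \<inter> E))"
      using f E by simp
    also have "\<dots> = (\<Sum>i<k. measure M (B i \<inter> E))"
      by (rule sum.reindex_bij_betw[OF \<pi>])
    also have "\<dots> = measure M (\<Union>i<k. B i \<inter> E)"
      using B E by (intro finite_measure_finite_Union[symmetric] dB) auto
    also have "\<dots> + measure M (E - ?U) = measure M ((\<Union>i<k. B i \<inter> E) \<union> (E - ?U))"
      using B E by (intro finite_measure_Union[symmetric]) auto
    also have "(\<Union>i<k. B i \<inter> E) \<union> (E - ?U) = E" by auto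
    finally show "emeasure (distr M borel \<sigma>) E = emeasure M E"
      using \<sigma>m E by (simp add: emeasure_distr emeasure_eq_measure)
  qed simp
  with \<sigma>m show thesis
    using f(2) \<sigma> by (intro that[of \<sigma>]) (fastforce simp: \<sigma>_def)+
qed

end

section \<open>Cyclical monotonicity of optimal maps\<close>

text \<open>The quantity minimised in Rockafellar's construction of a potential, with the distance
  as cost: jumps join successive pairs (x, T x), and the length of each pair is subtracted.\<close>

primrec chain_cost :: "('a::metric_space \<Rightarrow> 'a) \<Rightarrow> 'a \<Rightarrow> 'a list \<Rightarrow> 'a \<Rightarrow> real" where
  "chain_cost T p [] y = dist p y"
| "chain_cost T p (x # xs) y = dist p x - dist x (T x) + chain_cost T (T x) xs y"

text \<open>The usual cyclic condition on the graph of \<open>T\<close>, with the cycle cut open at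
  \<open>x\<close>.\<close>

definition cyclically_monotone :: "('a::metric_space \<Rightarrow> 'a) \<Rightarrow> 'a set \<Rightarrow> bool" where
  "cyclically_monotone T \<Gamma> \<longleftrightarrow>
    (\<forall>x\<in>\<Gamma>. \<forall>xs\<in>lists \<Gamma>. dist x (T x) \<le> chain_cost T (T x) xs x)"

lemma chain_cost_snoc: "chain_cost T p (xs @ [x]) y = chain_cost T p xs x - dist x (T x) + dist (T x) y"
  by (induction xs arbitrary: p) auto

lemma chain_cost_start: "chain_cost T p xs y \<le> dist p q + chain_cost T q xs y"
proof (cases xs)
  case Nil
  then show ?thesis by (simp add: dist_triangle)
next
  case (Cons x ys)
  then show ?thesis using dist_triangle[of p x q] by simp
qed

lemma chain_cost_end: "chain_cost T p xs y \<le> chain_cost T p xs z + dist z y"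
  by (induction xs arbitrary: p) (auto simp: dist_triangle add.assoc)

text \<open>Indexed form, to be matched with the cost of a cyclic shift of the targets.\<close>

lemma chain_cost_eq_sum:
  "chain_cost T (T x) xs z =
    (\<Sum>i<length xs. dist (T ((x # xs) ! i)) (xs ! i) - dist (xs ! i) (T (xs ! i)))
      + dist (T ((x # xs) ! length xs)) z"
proof (induction xs arbitrary: x)
  case (Cons a xs)
  show ?case
    by (simp add: Cons[of a] sum.lessThan_Suc_shift del: sum.lessThan_Suc)
qed simp

text \<open>
  The potential is the shortest-path distance from a fixed base point in the graph with edges
  \<open>a \<rightarrow> b\<close> of length \<open>dist a b\<close> and \<open>x \<rightarrow> T x\<close> of length \<open>- dist x (T x)\<close>; cyclical monotonicity
  excludes negative cycles.
\<close>

lemma cyclically_monotone_potential: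
  fixes T :: "'a::metric_space \<Rightarrow> 'a"
  assumes "cyclically_monotone T \<Gamma>"
  obtains v :: "'a \<Rightarrow> real" where "1-lipschitz_on UNIV v" "\<forall>x\<in>\<Gamma>. v x - v (T x) = dist x (T x)"
proof -
  define p :: 'a where "p = undefined"
  have lower: "- dist p y \<le> chain_cost T p xs y" if "xs \<in> lists \<Gamma>" for xs y
  proof (cases xs rule: rev_cases)
    case (snoc ys x)
    with that have x: "x \<in> \<Gamma>" "ys \<in> lists \<Gamma>" by auto
    \<comment> \<open>The path to \<open>x\<close>, closed up by returning from \<open>T x\<close>
      to the base point, is a cycle and so cannot be negative. This keeps the infimum below
      finite.\<close>
    have "dist x (T x) \<le> dist (T x) p + chain_cost T p ys x"
      using assms x chain_cost_start[of T "T x" ys x p] unfolding cyclically_monotone_def by force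
    moreover have "dist (T x) p \<le> dist (T x) y + dist p y"
      by (metis dist_commute dist_triangle)
    ultimately show ?thesis unfolding snoc chain_cost_snoc by linarith
  qed (use zero_le_dist[of p y] in simp)
  define v where "v y = (INF xs\<in>lists \<Gamma>. chain_cost T p xs y)" for y
  have bdd: "bdd_below ((\<lambda>xs. chain_cost T p xs y) ` lists \<Gamma>)" for y
    by (rule bdd_belowI2[of _ "- dist p y"]) (rule lower)
  have le: "v y \<le> chain_cost T p xs y" if "xs \<in> lists \<Gamma>" for xs y
    unfolding v_def using that by (intro cINF_lower bdd)
  have lip: "v y \<le> v z + dist z y" for y z
  proof -
    have "v y - dist z y \<le> chain_cost T p xs z" if "xs \<in> lists \<Gamma>" for xs
      using le[OF that, of y] chain_cost_end[of T p xs y z] by linarith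
    then have "v y - dist z y \<le> v z"
      unfolding v_def[of z] by (intro cINF_greatest) auto
    then show ?thesis by simp
  qed
  \<comment> \<open>Every path to \<open>x\<close> extends along the negative edge to a path to
    \<open>T x\<close>.\<close>
  have "v (T x) \<le> v x - dist x (T x)" if x: "x \<in> \<Gamma>" for x
  proof -
    have "v (T x) + dist x (T x) \<le> chain_cost T p xs x" if "xs \<in> lists \<Gamma>" for xs
      using le[of "xs @ [x]" "T x"] that x by (simp add: chain_cost_snoc)
    then have "v (T x) + dist x (T x) \<le> v x"
      unfolding v_def[of x] by (intro cINF_greatest) auto
    then show ?thesis by simp
  qed
  then have "v x - v (T x) = dist x (T x)" if "x \<in> \<Gamma>" for x
    using lip[of x "T x"] that by (force simp: dist_commute)
  moreover have "1-lipschitz_on UNIV v"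
  proof (rule lipschitz_onI)
    show "dist (v x) (v y) \<le> 1 * dist x y" for x y
      using lip[of x y] lip[of y x] by (auto simp: dist_real_def dist_commute)
  qed simp
  ultimately show thesis using that by blast
qed

context atomless_prob
begin

text \<open>The points off the support of the image measure are covered by countably many null basis
  sets. For g x = (x, T x), nearness controls a point together with its target, although
  \<open>T\<close> may be discontinuous.\<close>

lemma AE_in_support:
  fixes g :: "'a \<Rightarrow> 'b::{metric_space, second_countable_topology}"
  assumes [measurable]: "g \<in> borel_measurable borel"
  shows "AE x in M. \<forall>r>0. 0 < measure M {y. dist (g y) (g x) < r}"
proof -
  obtain \<B> :: "'b set set" where \<B>: "countable \<B>" "topological_basis \<B>"
    using ex_countable_basis by blast
  have m: "g -` X \<in> sets borel" if "open X" for X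
    using measurable_sets[OF assms, of X] that by auto
  define \<N> where "\<N> = {X \<in> \<B>. measure M (g -` X) = 0}"
  have "(\<Union>X\<in>\<N>. g -` X) \<in> null_sets M"
  proof (rule null_sets_UN')
    show "countable \<N>" using \<B>(1) unfolding \<N>_def by (rule countable_subset[rotated]) auto
    show "g -` X \<in> null_sets M" if "X \<in> \<N>" for X
      using that m[of X] topological_basis_open[OF \<B>(2), of X]
      by (auto simp: \<N>_def null_sets_def emeasure_eq_measure)
  qed
  then have "AE x in M. x \<notin> (\<Union>X\<in>\<N>. g -` X)" by (rule AE_not_in)
  then show ?thesis
  proof (eventually_elim, intro allI impI)
    fix x and r :: real assume x: "x \<notin> (\<Union>X\<in>\<N>. g -` X)" and "r > 0"
    then obtain X where X: "X \<in> \<B>" "g x \<in> X" "X \<subseteq> ball (g x) r"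
      using topological_basisE[OF \<B>(2) open_ball, of "g x" "g x" r] by auto
    have "measure M (g -` X) \<noteq> 0" using x X by (auto simp: \<N>_def)
    moreover have "measure M (g -` X) \<le> measure M {y. dist (g y) (g x) < r}"
    proof (rule finite_measure_mono)
      show "g -` X \<subseteq> {y. dist (g y) (g x) < r}" using X(3) by (auto simp: dist_commute subset_eq)
    qed simp
    ultimately show "0 < measure M {y. dist (g y) (g x) < r}"
      by (metis measure_nonneg order_le_less order_less_le_trans)
  qed
qed

text \<open>
  If the transport along a cycle of support points could be improved, it would still be improved
  after permuting small sets of equal mass around these points.
\<close>

lemma optimal_map_permutation:
  fixes T :: "'a \<Rightarrow> 'a" and k :: nat
  assumes T [measurable]: "T \<in> borel_measurable borel" and "bounded \<Omega>"
    and \<Omega>: "AE x in M. x \<in> \<Omega>" "\<And>x. T x \<in> \<Omega>"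
    and opt: "\<And>\<sigma>. \<sigma> \<in> borel_measurable borel \<Longrightarrow> distr M borel \<sigma> = M \<Longrightarrow>
      (LINT x|M. dist x (T x)) \<le> (LINT x|M. dist x (T (\<sigma> x)))"
    and a: "\<And>i r. i < k \<Longrightarrow> 0 < r \<Longrightarrow> 0 < measure M {y. dist (y, T y) (a i, T (a i)) < r}"
    and \<pi>: "bij_betw \<pi> {..<k} {..<k}"
  shows "(\<Sum>i<k. dist (a i) (T (a i))) \<le> (\<Sum>i<k. dist (a i) (T (a (\<pi> i))))"
proof (rule ccontr)
  define D where "D = (\<Sum>i<k. dist (a i) (T (a i))) - (\<Sum>i<k. dist (a i) (T (a (\<pi> i))))"
  assume "\<not> ?thesis"
  then have D: "D > 0" by (simp add: D_def)
  then have k: "k > 0" by (auto simp: D_def intro!: Nat.gr0I)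
  \<comment> \<open>Comparing points and targets with those of the centre \<open>a i\<close> costs
    at most 4 r per piece and unit of mass; over k pieces this is 4 D / 5, less than the gain
    D.\<close>
  define r where "r = D / (5 * k)"
  have r: "r > 0" using D k by (simp add: r_def)
  define A where "A i = {y. dist (y, T y) (a i, T (a i)) < r}" for i
  have [measurable]: "A i \<in> sets borel" for i
    unfolding A_def by measurable
  define m where "m = Min ((\<lambda>i. measure M (A i)) ` {..<k}) / k"
  have m: "m > 0"
    using k a[OF _ r] by (auto simp: m_def A_def intro!: divide_pos_pos Min_gr_iff[THEN iffD2])
  have "k * m \<le> measure M (A i)" if "i < k" for i
    using k that by (auto simp: m_def intro!: Min_le)
  then obtain B where B: "\<And>i. i < k \<Longrightarrow> B i \<in> sets borel" "\<And>i. i < k \<Longrightarrow> B i \<subseteq> A i"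
    "\<And>i. i < k \<Longrightarrow> measure M (B i) = m" and disj: "disjoint_family_on B {..<k}"
    using disjoint_subsets_of_measure[of k A m] m by auto
  obtain \<sigma> where \<sigma> [measurable]: "\<sigma> \<in> borel_measurable borel" and \<sigma>M: "distr M borel \<sigma> = M"
    and \<sigma>B: "\<And>i x. i < k \<Longrightarrow> x \<in> B i \<Longrightarrow> \<sigma> x \<in> B (\<pi> i)" "\<And>x. x \<notin> (\<Union>i<k. B i) \<Longrightarrow> \<sigma> x = x"
    using measure_preserving_permutation[OF B(1,3) m disj \<pi>] by metis
  define c where "c i = dist (a i) (T (a (\<pi> i))) - dist (a i) (T (a i)) + 4 * r" for i
  have near: "dist x (a i) < r" "dist (T x) (T (a i)) < r" if "i < k" "x \<in> B i" for i x
    using subsetD[OF B(2)[OF that(1)] that(2)] dist_fst_le[of "(x, T x)" "(a i, T (a i))"]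
      dist_snd_le[of "(x, T x)" "(a i, T (a i))"] by (auto simp: A_def)
  have pointwise: "dist x (T (\<sigma> x)) \<le> dist x (T x) + (\<Sum>i<k. indicator (B i) x * c i)" for x
  proof (cases "x \<in> (\<Union>i<k. B i)")
    case True
    then obtain i where i: "i < k" "x \<in> B i" by auto
    have \<pi>i: "\<pi> i < k" using \<pi> i unfolding bij_betw_def by blast
    have "indicator (B j) x = (if j = i then 1 else 0 :: real)" if "j < k" for j
      using disj i that unfolding disjoint_family_on_def indicator_def by auto
    then have "(\<Sum>j<k. indicator (B j) x * c j) = (\<Sum>j<k. if j = i then c j else 0)"
      by (intro sum.cong) auto
    also have "\<dots> = c i" using i by simp
    finally have "(\<Sum>j<k. indicator (B j) x * c j) = c i" .
    moreover have "dist x (T (\<sigma> x)) \<le> dist x (a i) + dist (a i) (T (a (\<pi> i))) + dist (T (\<sigma> x)) (T (a (\<pi> i)))"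
      by (smt (verit) dist_commute dist_triangle)
    moreover have "dist (a i) (T (a i)) \<le> dist x (a i) + dist x (T x) + dist (T x) (T (a i))"
      by (smt (verit) dist_commute dist_triangle)
    ultimately show ?thesis
      using near[OF i] near[OF \<pi>i \<sigma>B(1)[OF i]] unfolding c_def by linarith
  next
    case False
    then show ?thesis by (simp add: \<sigma>B(2))
  qed
  obtain b where b: "\<And>x y. x \<in> \<Omega> \<Longrightarrow> y \<in> \<Omega> \<Longrightarrow> dist x y \<le> b"
    using \<open>bounded \<Omega>\<close> bounded_two_points by metis
  have int: "integrable M (\<lambda>x. dist x (T (\<tau> x)))" if [measurable]: "\<tau> \<in> borel_measurable borel" for \<tau>
    using \<Omega>(1) by (intro integrable_const_bound[where B=b]) (auto elim!: eventually_mono intro!: b \<Omega>(2))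
  have intB: "integrable M (\<lambda>x. indicator (B i) x * c i)" if "i < k" for i
    using B(1)[OF that] by (intro integrable_mult_left integrable_real_indicator) (auto simp: emeasure_eq_measure)
  have int_id: "integrable M (\<lambda>x. dist x (T x))" using int[of "\<lambda>x. x"] by simp
  have intS: "integrable M (\<lambda>x. \<Sum>i<k. indicator (B i) x * c i)"
    by (rule Bochner_Integration.integrable_sum) (rule intB, simp)
  have "(LINT x|M. dist x (T (\<sigma> x))) \<le> (LINT x|M. dist x (T x) + (\<Sum>i<k. indicator (B i) x * c i))"
    by (rule integral_mono[OF int[OF \<sigma>] Bochner_Integration.integrable_add[OF int_id intS] pointwise])
  also have "\<dots> = (LINT x|M. dist x (T x)) + (\<Sum>i<k. LINT x|M. indicator (B i) x * c i)"
    using Bochner_Integration.integral_sum[of "{..<k}" M "\<lambda>i x. indicator (B i) x * c i"] intB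
    unfolding Bochner_Integration.integral_add[OF int_id intS] by (simp only: lessThan_iff)
  also have "(\<Sum>i<k. LINT x|M. indicator (B i) x * c i) = (\<Sum>i<k. m * c i)"
    using B by (intro sum.cong) (auto simp: emeasure_eq_measure)
  also have "\<dots> = m * (4 * r * k - D)"
    by (simp add: c_def D_def sum_distrib_left[symmetric] sum.distrib sum_subtractf)
  also have "\<dots> < 0" using m D k by (intro mult_pos_neg) (auto simp: r_def field_simps)
  finally show False using opt[OF \<sigma> \<sigma>M] by simp
qed

lemma optimal_map_potential:
  fixes T :: "'a \<Rightarrow> 'a"
  assumes T [measurable]: "T \<in> borel_measurable borel" and "bounded \<Omega>"
    and \<Omega>: "AE x in M. x \<in> \<Omega>" "\<And>x. T x \<in> \<Omega>"
    and opt: "\<And>\<sigma>. \<sigma> \<in> borel_measurable borel \<Longrightarrow> distr M borel \<sigma> = M \<Longrightarrow>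
      (LINT x|M. dist x (T x)) \<le> (LINT x|M. dist x (T (\<sigma> x)))"
  obtains v :: "'a \<Rightarrow> real" where "1-lipschitz_on UNIV v" "AE x in M. v x - v (T x) = dist x (T x)"
proof -
  define \<Gamma> where "\<Gamma> = {x. \<forall>r>0. 0 < measure M {y. dist (y, T y) (x, T x) < r}}"
  have "cyclically_monotone T \<Gamma>"
    unfolding cyclically_monotone_def
  proof (intro ballI)
    fix x xs assume x: "x \<in> \<Gamma>" and xs: "xs \<in> lists \<Gamma>"
    define n where "n = length xs"
    define a where "a i = (x # xs) ! i" for i
    \<comment> \<open>Backward shift of the closed cycle: each point receives the target of its
      predecessor, the head \<open>x\<close> that of the last point.\<close>
    define \<pi> where "\<pi> i = (if i = 0 then n else i - 1)" for i
    have "a i \<in> \<Gamma>" if "i < Suc n" for i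
    proof -
      have "set (x # xs) \<subseteq> \<Gamma>" using x xs by auto
      moreover have "a i \<in> set (x # xs)" using that unfolding a_def n_def by (intro nth_mem) simp
      ultimately show ?thesis by blast
    qed
    moreover have "bij_betw \<pi> {..<Suc n} {..<Suc n}"
      by (rule bij_betw_byWitness[where f'="\<lambda>i. if i = n then 0 else Suc i"]) (auto simp: \<pi>_def)
    ultimately have "(\<Sum>i<Suc n. dist (a i) (T (a i))) \<le> (\<Sum>i<Suc n. dist (a i) (T (a (\<pi> i))))"
      by (intro optimal_map_permutation[OF T \<open>bounded \<Omega>\<close> \<Omega> opt]) (auto simp: \<Gamma>_def)
    then have "dist x (T x) + (\<Sum>i<n. dist (xs ! i) (T (xs ! i))) \<le>
        dist x (T (a n)) + (\<Sum>i<n. dist (xs ! i) (T (a i)))"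
      by (simp add: sum.lessThan_Suc_shift \<pi>_def a_def del: sum.lessThan_Suc)
    then show "dist x (T x) \<le> chain_cost T (T x) xs x"
      unfolding chain_cost_eq_sum n_def[symmetric] a_def[symmetric]
      by (simp add: sum_subtractf dist_commute)
  qed
  then obtain v :: "'a \<Rightarrow> real" where v: "1-lipschitz_on UNIV v" "\<forall>x\<in>\<Gamma>. v x - v (T x) = dist x (T x)"
    by (rule cyclically_monotone_potential)
  moreover have "AE x in M. x \<in> \<Gamma>"
    using AE_in_support[of "\<lambda>x. (x, T x)"] unfolding \<Gamma>_def by simp
  then have "AE x in M. v x - v (T x) = dist x (T x)"
    by eventually_elim (use v(2) in blast)
  ultimately show thesis using that by blast
qed

end

section \<open>Transport rays\<close>

text \<open>A finite measure has room for only finitely many disjoint sets of measure above 1 / (n +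
  1), hence for only countably many of positive measure.\<close>

lemma (in finite_measure) uncountable_disjoint_null_set:
  assumes "uncountable I" and disj: "disjoint_family_on Y I" and Y: "\<And>i. i \<in> I \<Longrightarrow> Y i \<in> sets M"
  obtains i where "i \<in> I" "Y i \<in> null_sets M"
proof (rule ccontr)
  assume "\<not> thesis"
  with that have pos: "0 < measure M (Y i)" if "i \<in> I" for i
    using that Y by (metis emeasure_eq_measure ennreal_0 null_setsI zero_less_measure_iff)
  have "finite {i \<in> I. 1 / real (Suc n) < measure M (Y i)}" for n
  proof (rule conjunct1[OF finite_if_finite_subsets_card_bdd])
    fix J assume J: "J \<subseteq> {i \<in> I. 1 / real (Suc n) < measure M (Y i)}" "finite J"
    have "real (card J) / real (Suc n) = (\<Sum>i\<in>J. 1 / real (Suc n))" by simp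
    also have "\<dots> \<le> (\<Sum>i\<in>J. measure M (Y i))"
      using J by (intro sum_mono) auto
    also have "\<dots> = measure M (\<Union>i\<in>J. Y i)"
      using J Y disj by (intro finite_measure_finite_Union[symmetric]) (auto simp: disjoint_family_on_def subset_eq)
    also have "\<dots> \<le> measure M (space M)" by (rule bounded_measure)
    finally have "real (card J) \<le> measure M (space M) * real (Suc n)" by (simp add: field_simps)
    then show "card J \<le> nat \<lceil>measure M (space M) * real (Suc n)\<rceil>"
      by linarith
  qed
  then have "countable (\<Union>n. {i \<in> I. 1 / real (Suc n) < measure M (Y i)})"
    by (intro countable_UN countableI_type countable_finite)
  moreover have "I \<subseteq> (\<Union>n. {i \<in> I. 1 / real (Suc n) < measure M (Y i)})"
  proof
    fix i assume "i \<in> I"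
    moreover obtain n where "1 / real (Suc n) < measure M (Y i)"
      using nat_approx_posE[OF pos[OF \<open>i \<in> I\<close>]] by metis
    ultimately show "i \<in> (\<Union>n. {i \<in> I. 1 / real (Suc n) < measure M (Y i)})" by auto
  qed
  ultimately have "countable I" by (rule countable_subset[rotated])
  with assms(1) show False ..
qed

text \<open>The equality case of the triangle inequality; it excludes a kink where two rays
  meet.\<close>

lemma equal_sum_unit:
  fixes p q :: "'a::real_inner"
  assumes "norm p = 1" "norm q = 1" "0 < s" "0 < t" "s + t \<le> norm (s *\<^sub>R q + t *\<^sub>R p)"
  shows "q = p"
proof -
  have "norm (s *\<^sub>R q + t *\<^sub>R p) = norm (s *\<^sub>R q) + norm (t *\<^sub>R p)"
    using assms norm_triangle_ineq[of "s *\<^sub>R q" "t *\<^sub>R p"] by simp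
  then have "(s * t) *\<^sub>R q = (s * t) *\<^sub>R p"
    using assms unfolding norm_triangle_eq by (simp add: mult.commute)
  then show ?thesis using assms by simp
qed

lemma parallelogram:
  fixes a b :: "'a::real_inner"
  shows "(norm (a + b))\<^sup>2 + (norm (a - b))\<^sup>2 = 2 * (norm a)\<^sup>2 + 2 * (norm b)\<^sup>2"
  by (simp add: power2_norm_eq_inner inner_simps inner_commute)

section \<open>Geometry of the rays of a 1-Lipschitz function\<close>

locale ray_domain =
  fixes \<Omega> :: "'a::euclidean_space set" and u :: "'a \<Rightarrow> real"
  assumes compact: "compact \<Omega>" and convex: "convex \<Omega>" and lip: "1-lipschitz_on UNIV u"
begin

lemma u_le: "u x \<le> u y + norm (x - y)"
  using lipschitz_onD[OF lip, of x y] by (auto simp: dist_norm)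

text \<open>
  \<open>ray s t y p\<close>: the point \<open>y\<close> lies on a transport ray of direction \<open>p\<close>, along which \<open>u\<close> grows with
  slope 1, and this ray extends from \<open>y\<close> by \<open>s\<close> upwards and by \<open>t\<close> downwards inside \<open>\<Omega>\<close>.
\<close>

definition ray :: "real \<Rightarrow> real \<Rightarrow> 'a \<Rightarrow> 'a \<Rightarrow> bool" where
  "ray s t y p \<longleftrightarrow> norm p = 1 \<and> y \<in> \<Omega> \<and> y + s *\<^sub>R p \<in> \<Omega> \<and> y - t *\<^sub>R p \<in> \<Omega> \<and>
     u (y + s *\<^sub>R p) = u y + s \<and> u (y - t *\<^sub>R p) = u y - t"

text \<open>A 1-Lipschitz function that gains the full length over a segment does so over each part,
  since otherwise the remainder would need slope above 1. Convexity keeps the intermediate points in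
  \<open>\<Omega>\<close>.\<close>

lemma ray_shrink:
  assumes "ray s t y p" "0 \<le> s'" "s' \<le> s" "0 \<le> t'" "t' \<le> t"
  shows "ray s' t' y p"
proof -
  have p: "norm p = 1" and y: "y \<in> \<Omega>" "y + s *\<^sub>R p \<in> \<Omega>" "y - t *\<^sub>R p \<in> \<Omega>"
    and u: "u (y + s *\<^sub>R p) = u y + s" "u (y - t *\<^sub>R p) = u y - t"
    using assms(1) unfolding ray_def by auto
  have in_between: "y + a' *\<^sub>R q \<in> \<Omega>" if "y + a *\<^sub>R q \<in> \<Omega>" "0 \<le> a'" "a' \<le> a" for a a' q
  proof (cases "a = 0")
    case False
    have "(1 - a' / a) *\<^sub>R y + (a' / a) *\<^sub>R (y + a *\<^sub>R q) \<in> \<Omega>"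
      using that False by (intro convexD[OF convex y(1)]) auto
    also have "(1 - a' / a) *\<^sub>R y + (a' / a) *\<^sub>R (y + a *\<^sub>R q) = y + a' *\<^sub>R q"
      using False by (simp add: algebra_simps)
    finally show ?thesis .
  qed (use that y in auto)
  have "u (y + s *\<^sub>R p) \<le> u (y + s' *\<^sub>R p) + (s - s')"
    using u_le[of "y + s *\<^sub>R p" "y + s' *\<^sub>R p"] p assms by (simp flip: scaleR_left_diff_distrib)
  moreover have "u (y + s' *\<^sub>R p) \<le> u y + s'"
    using u_le[of "y + s' *\<^sub>R p" y] p assms by simp
  moreover have "u y \<le> u (y - t' *\<^sub>R p) + t'"
    using u_le[of y "y - t' *\<^sub>R p"] p assms by simp
  moreover have "u (y - t' *\<^sub>R p) \<le> u (y - t *\<^sub>R p) + (t - t')"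
    using u_le[of "y - t' *\<^sub>R p" "y - t *\<^sub>R p"] p assms by (simp flip: scaleR_left_diff_distrib)
  ultimately show ?thesis
    using p y u in_between[of s p s'] in_between[of t "- p" t'] assms unfolding ray_def by auto
qed

lemma ray_down:
  assumes "ray s t y p" "0 \<le> s" "0 \<le> h" "h \<le> t"
  shows "ray (s + h) (t - h) (y - h *\<^sub>R p) p"
  using ray_shrink[of s t y p 0 h] assms unfolding ray_def by (simp add: algebra_simps)

lemma ray_up:
  assumes "ray s t y p" "0 \<le> t" "0 \<le> h" "h \<le> s"
  shows "ray (s - h) (t + h) (y + h *\<^sub>R p) p"
  using ray_shrink[of s t y p h 0] assms unfolding ray_def by (simp add: algebra_simps)

text \<open>Between the outer ends of the two rays \<open>u\<close> gains s + t, so these ends are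
  at least s + t apart and the two segments are aligned.\<close>

lemma ray_join:
  assumes q: "ray s 0 y q" "0 < s" and p: "ray 0 t y p" "0 < t"
  shows "ray s t y p"
proof -
  have "u (y + s *\<^sub>R q) \<le> u (y - t *\<^sub>R p) + norm (s *\<^sub>R q + t *\<^sub>R p)"
    using u_le[of "y + s *\<^sub>R q" "y - t *\<^sub>R p"] by simp
  then have "s + t \<le> norm (s *\<^sub>R q + t *\<^sub>R p)"
    using q p unfolding ray_def by simp
  then have "q = p"
    using q p unfolding ray_def by (intro equal_sum_unit[of p q s t]) auto
  then show ?thesis using q p unfolding ray_def by simp
qed

text \<open>
  Crossing the two rays and adding the two resulting Lipschitz estimates, the parallelogram law
  shows that directions depend on the point in a Lipschitz way.
\<close>

lemma ray_direction_lipschitz: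
  assumes "0 < \<delta>" and p: "ray \<delta> \<delta> y p" and q: "ray \<delta> \<delta> z q"
  shows "norm (p - q) \<le> norm (y - z) / \<delta>"
\<comment> \<open>For near points the lower bounds 2 \<delta> + d and 2 \<delta> - d are nonnegative
  and can be squared; for far points it suffices that two unit vectors differ by at most 2.\<close>
proof (cases "norm (y - z) \<le> 2 * \<delta>")
  case True
  define w where "w = y - z"
  define d where "d = u y - u z"
  have np: "norm p = 1" "norm q = 1" using p q unfolding ray_def by auto
  have "\<bar>d\<bar> \<le> norm w"
    using u_le[of y z] u_le[of z y] by (auto simp: d_def w_def norm_minus_commute)
  with True have d: "\<bar>d\<bar> \<le> 2 * \<delta>" by (simp add: w_def)
  have 1: "2 * \<delta> + d \<le> norm (\<delta> *\<^sub>R (p + q) + w)"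
    using u_le[of "y + \<delta> *\<^sub>R p" "z - \<delta> *\<^sub>R q"] p q unfolding ray_def d_def w_def
    by (simp add: algebra_simps)
  have 2: "2 * \<delta> - d \<le> norm (\<delta> *\<^sub>R (p + q) - w)"
    using u_le[of "z + \<delta> *\<^sub>R q" "y - \<delta> *\<^sub>R p"] p q unfolding ray_def d_def w_def
    by (simp add: algebra_simps)
  have "(2 * \<delta> + d)\<^sup>2 + (2 * \<delta> - d)\<^sup>2 \<le> (norm (\<delta> *\<^sub>R (p + q) + w))\<^sup>2 + (norm (\<delta> *\<^sub>R (p + q) - w))\<^sup>2"
    using d 1 2 by (intro add_mono power_mono) auto
  also have "\<dots> = 2 * (norm (\<delta> *\<^sub>R (p + q)))\<^sup>2 + 2 * (norm w)\<^sup>2"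
    by (rule parallelogram)
  finally have "4 * \<delta>\<^sup>2 \<le> \<delta>\<^sup>2 * (norm (p + q))\<^sup>2 + (norm w)\<^sup>2"
  proof -
    assume "(2 * \<delta> + d)\<^sup>2 + (2 * \<delta> - d)\<^sup>2 \<le> 2 * (norm (\<delta> *\<^sub>R (p + q)))\<^sup>2 + 2 * (norm w)\<^sup>2"
    moreover have "(2 * \<delta> + d)\<^sup>2 + (2 * \<delta> - d)\<^sup>2 = 8 * \<delta>\<^sup>2 + 2 * d\<^sup>2"
      by (simp add: power2_eq_square algebra_simps)
    moreover have "(norm (\<delta> *\<^sub>R (p + q)))\<^sup>2 = \<delta>\<^sup>2 * (norm (p + q))\<^sup>2"
      by (simp add: power_mult_distrib del: scaleR_right_distrib scaleR_add_right)
    ultimately show ?thesis using zero_le_power2[of d] by linarith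
  qed
  moreover have "(norm (p + q))\<^sup>2 = 4 - (norm (p - q))\<^sup>2"
    using parallelogram[of p q] np by simp
  ultimately have "(\<delta> * norm (p - q))\<^sup>2 \<le> (norm w)\<^sup>2"
    by (simp add: power_mult_distrib right_diff_distrib mult.commute)
  then have "\<delta> * norm (p - q) \<le> norm w"
    by (rule power2_le_imp_le) simp
  then show ?thesis using \<open>0 < \<delta>\<close> by (simp add: w_def field_simps)
next
  case False
  have "norm (p - q) \<le> 2"
    using norm_triangle_ineq4[of p q] p q unfolding ray_def by simp
  also have "2 \<le> norm (y - z) / \<delta>" using False \<open>0 < \<delta>\<close> by (simp add: field_simps)
  finally show ?thesis .
qed

lemma ray_unique:
  assumes "0 < \<delta>" "ray \<delta> \<delta> y p" "ray \<delta> \<delta> y q"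
  shows "p = q"
  using ray_direction_lipschitz[OF assms] by simp

text \<open>Second-order bound for the distance to a point \<delta> away, obtained by completing the
  square.\<close>

lemma norm_shift_le:
  assumes "norm p = 1" "0 < \<delta>"
  shows "norm (\<delta> *\<^sub>R p + h) \<le> \<delta> + h \<bullet> p + (norm h)\<^sup>2 / (2 * \<delta>)"
proof (rule power2_le_imp_le)
  have "(norm (\<delta> *\<^sub>R p + h))\<^sup>2 = \<delta>\<^sup>2 + 2 * \<delta> * (h \<bullet> p) + (norm h)\<^sup>2"
    using assms unfolding norm_eq_1
    by (simp add: power2_norm_eq_inner inner_simps inner_commute) (simp add: power2_eq_square)
  also have "\<dots> = (\<delta> + h \<bullet> p + (norm h)\<^sup>2 / (2 * \<delta>))\<^sup>2 - (h \<bullet> p + (norm h)\<^sup>2 / (2 * \<delta>))\<^sup>2"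
    using assms by (simp add: power2_eq_square field_simps)
  finally show "(norm (\<delta> *\<^sub>R p + h))\<^sup>2 \<le> (\<delta> + h \<bullet> p + (norm h)\<^sup>2 / (2 * \<delta>))\<^sup>2"
    by simp
  have "\<bar>h \<bullet> p\<bar> \<le> norm h" using Cauchy_Schwarz_ineq2[of h p] assms by simp
  moreover have "norm h \<le> \<delta> + (norm h)\<^sup>2 / (2 * \<delta>)"
  proof -
    have "0 \<le> (norm h - \<delta>)\<^sup>2 + \<delta>\<^sup>2" by simp
    then show ?thesis using assms by (simp add: power2_eq_square field_simps)
  qed
  ultimately show "0 \<le> \<delta> + h \<bullet> p + (norm h)\<^sup>2 / (2 * \<delta>)" by linarith
qed

text \<open>The Lipschitz condition puts \<open>u\<close> below the upward cone with apex y -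
  \<delta> p and above the downward cone with apex y + \<delta> p. Both cones touch \<open>u\<close>
  at y with the same gradient p.\<close>

lemma ray_quadratic:
  assumes "0 < \<delta>" "ray \<delta> \<delta> y p"
  shows "\<bar>u (y + h) - u y - h \<bullet> p\<bar> \<le> (norm h)\<^sup>2 / (2 * \<delta>)"
proof -
  have p: "norm p = 1" using assms unfolding ray_def by simp
  have "u (y + h) \<le> u (y - \<delta> *\<^sub>R p) + norm (\<delta> *\<^sub>R p + h)"
    using u_le[of "y + h" "y - \<delta> *\<^sub>R p"] by (simp add: algebra_simps)
  moreover have "u (y + \<delta> *\<^sub>R p) \<le> u (y + h) + norm (\<delta> *\<^sub>R p + (- h))"
    using u_le[of "y + \<delta> *\<^sub>R p" "y + h"] by (simp add: algebra_simps)
  ultimately show ?thesis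
    using norm_shift_le[OF p assms(1), of h] norm_shift_le[OF p assms(1), of "- h"] assms
    unfolding ray_def by simp
qed

lemma ray_GDERIV:
  assumes "0 < \<delta>" "ray \<delta> \<delta> y p"
  shows "GDERIV u y :> p"
  unfolding gderiv_def
proof (rule has_derivativeI_sandwich[of 1])
  show "norm ((u x - u y) - (x - y) \<bullet> p) / norm (x - y) \<le> norm (x - y) / (2 * \<delta>)"
    if "x \<noteq> y" for x
    using ray_quadratic[OF assms, of "x - y"] that assms(1)
    by (simp add: power2_eq_square field_simps)
  have "((\<lambda>x. norm (x - y) / (2 * \<delta>)) \<longlongrightarrow> norm (y - y) / (2 * \<delta>)) (at y)"
    by (intro tendsto_intros) (use assms in auto)
  then show "((\<lambda>x. norm (x - y) / (2 * \<delta>)) \<longlongrightarrow> 0) (at y)" by simp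
qed (auto intro: bounded_linear_inner_left)

section \<open>Null sets and motion along rays\<close>

definition ray_set :: "real \<Rightarrow> real \<Rightarrow> 'a set" where
  "ray_set s t = {y. \<exists>p. ray s t y p}"

lemma ray_set_subset: "ray_set s t \<subseteq> \<Omega>"
  unfolding ray_set_def ray_def by auto

text \<open>A projection of a compact set of pairs of points and unit directions; this yields Borel
  sets without a measurable selection of directions.\<close>

lemma compact_ray_set: "compact (ray_set s t)"
proof -
  have u: "continuous_on UNIV u" by (rule lipschitz_on_continuous_on[OF lip])
  have cont: "continuous_on UNIV (\<lambda>z. u (f z))" if "continuous_on UNIV f" for f :: "'a \<times> 'a \<Rightarrow> 'a"
    by (rule continuous_on_compose2[OF u that]) simp
  have vim: "closed {z. f z \<in> \<Omega>}" if "continuous_on UNIV f" for f :: "'a \<times> 'a \<Rightarrow> 'a"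
    using closed_vimage[OF compact_imp_closed[OF compact] that] by (simp add: vimage_def)
  have "closed {z. fst z + s *\<^sub>R snd z \<in> \<Omega> \<and> fst z - t *\<^sub>R snd z \<in> \<Omega> \<and>
      u (fst z + s *\<^sub>R snd z) = u (fst z) + s \<and> u (fst z - t *\<^sub>R snd z) = u (fst z) - t}"
    by (intro closed_Collect_conj vim closed_Collect_eq continuous_intros cont)
  then have "compact ((\<Omega> \<times> sphere 0 1) \<inter> {z. fst z + s *\<^sub>R snd z \<in> \<Omega> \<and> fst z - t *\<^sub>R snd z \<in> \<Omega> \<and>
      u (fst z + s *\<^sub>R snd z) = u (fst z) + s \<and> u (fst z - t *\<^sub>R snd z) = u (fst z) - t})"
    by (intro compact_Int_closed compact_Times compact compact_sphere)
  then have "compact (fst ` ((\<Omega> \<times> sphere 0 1) \<inter> {z. fst z + s *\<^sub>R snd z \<in> \<Omega> \<and> fst z - t *\<^sub>R snd z \<in> \<Omega> \<and>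
      u (fst z + s *\<^sub>R snd z) = u (fst z) + s \<and> u (fst z - t *\<^sub>R snd z) = u (fst z) - t}))"
    by (intro compact_continuous_image continuous_intros)
  also have "fst ` ((\<Omega> \<times> sphere 0 1) \<inter> {z. fst z + s *\<^sub>R snd z \<in> \<Omega> \<and> fst z - t *\<^sub>R snd z \<in> \<Omega> \<and>
      u (fst z + s *\<^sub>R snd z) = u (fst z) + s \<and> u (fst z - t *\<^sub>R snd z) = u (fst z) - t}) = ray_set s t"
    by (force simp: ray_set_def ray_def image_iff)
  finally show ?thesis .
qed

lemma ray_set_borel [measurable]: "ray_set s t \<in> sets borel"
  using compact_ray_set by (intro borel_closed compact_imp_closed)

text \<open>Only the direction at y enters, so the shift a may have either sign and may exceed
  \<delta>.\<close>

lemma ray_flow: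
  assumes "0 < \<delta>"
  obtains G where "\<forall>y p. ray \<delta> \<delta> y p \<longrightarrow> G y = y + a *\<^sub>R p"
    "(1 + \<bar>a\<bar> / \<delta>)-lipschitz_on (ray_set \<delta> \<delta>) G"
proof -
  define G where "G y = y + a *\<^sub>R (SOME p. ray \<delta> \<delta> y p)" for y
  have G: "G y = y + a *\<^sub>R p" if "ray \<delta> \<delta> y p" for y p
    using that ray_unique[OF assms] someI[of "ray \<delta> \<delta> y" p] unfolding G_def by metis
  moreover have "(1 + \<bar>a\<bar> / \<delta>)-lipschitz_on (ray_set \<delta> \<delta>) G"
  proof (rule lipschitz_onI)
    fix y z assume "y \<in> ray_set \<delta> \<delta>" "z \<in> ray_set \<delta> \<delta>"
    then obtain p q where pq: "ray \<delta> \<delta> y p" "ray \<delta> \<delta> z q" unfolding ray_set_def by auto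
    have "dist (G y) (G z) = norm ((y - z) + a *\<^sub>R (p - q))"
      using G[OF pq(1)] G[OF pq(2)] by (simp add: dist_norm algebra_simps)
    also have "\<dots> \<le> norm (y - z) + \<bar>a\<bar> * norm (p - q)"
      using norm_triangle_ineq[of "y - z" "a *\<^sub>R (p - q)"] by simp
    also have "\<dots> \<le> norm (y - z) + \<bar>a\<bar> * (norm (y - z) / \<delta>)"
      by (intro add_left_mono mult_left_mono ray_direction_lipschitz assms pq) simp
    finally show "dist (G y) (G z) \<le> (1 + \<bar>a\<bar> / \<delta>) * dist y z"
      by (simp add: dist_norm algebra_simps)
  qed (use assms in simp)
  ultimately show thesis using that by blast
qed

lemma negligible_lipschitz_image:
  fixes G :: "'a \<Rightarrow> 'a"
  assumes "L-lipschitz_on S G" "negligible E" "E \<subseteq> S"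
  shows "negligible (G ` E)"
proof (rule negligible_locally_Lipschitz_image[OF order_refl assms(2)])
  show "\<exists>T B. open T \<and> x \<in> T \<and> (\<forall>y\<in>E \<inter> T. norm (G y - G x) \<le> B * norm (y - x))" if "x \<in> E" for x
    using lipschitz_onD[OF assms(1)] that assms(3)
    by (intro exI[of _ UNIV] exI[of _ L]) (auto simp: dist_norm)
qed

text \<open>After the descent there is length a of ray above the point and \<delta> below it. So the
  way back up is a Lipschitz map, and it covers the preimage by the image of a null set.\<close>

lemma negligible_descent_preimage:
  assumes "0 < a" "0 < \<delta>" "negligible E"
  shows "negligible {x. \<exists>p. ray 0 (a + \<delta>) x p \<and> x - a *\<^sub>R p \<in> E}"
proof -
  define r where "r = min a \<delta>"
  have r: "0 < r" using assms by (simp add: r_def)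
  obtain G where G: "\<forall>y p. ray r r y p \<longrightarrow> G y = y + a *\<^sub>R p"
    and lipG: "(1 + \<bar>a\<bar> / r)-lipschitz_on (ray_set r r) G"
    by (rule ray_flow[OF r])
  have "negligible (G ` (E \<inter> ray_set r r))"
    by (intro negligible_lipschitz_image[OF lipG] negligible_subset[OF assms(3)]) auto
  then show ?thesis
  proof (rule negligible_subset, safe)
    fix x p assume ray: "ray 0 (a + \<delta>) x p" and E: "x - a *\<^sub>R p \<in> E"
    have "ray (0 + a) (a + \<delta> - a) (x - a *\<^sub>R p) p"
      using assms by (intro ray_down ray) auto
    then have "ray r r (x - a *\<^sub>R p) p"
      using assms by (auto simp: r_def elim!: ray_shrink)
    with E show "x \<in> G ` (E \<inter> ray_set r r)"
      by (intro image_eqI[of _ _ "x - a *\<^sub>R p"]) (auto simp: G ray_set_def)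
  qed
qed

text \<open>The lengths 1 / (n + 1) detect every upward extension and keep the set Borel.\<close>

definition upper_ends :: "real \<Rightarrow> 'a set" where
  "upper_ends \<delta> = ray_set 0 \<delta> - (\<Union>n. ray_set (1 / Suc n) 0)"

lemma upper_endsD: "ray s 0 x p \<Longrightarrow> 0 < s \<Longrightarrow> x \<notin> upper_ends \<delta>"
proof -
  assume ray: "ray s 0 x p" and "0 < s"
  then obtain n where "1 / Suc n < s" using nat_approx_posE by blast
  then have "ray (1 / Suc n) 0 x p" by (intro ray_shrink[OF ray]) auto
  then have "x \<in> ray_set (1 / Suc n) 0"
    unfolding ray_set_def by blast
  then show ?thesis unfolding upper_ends_def by blast
qed

text \<open>
  Moving the upper ends down their rays by a length \<open>t\<close> produces disjoint sets for different \<open>t\<close>. One of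
  these uncountably many sets is null, and the set of upper ends is its image under a Lipschitz map.
\<close>

lemma negligible_upper_ends:
  assumes "0 < \<delta>"
  shows "negligible (upper_ends \<delta>)"
proof -
  have \<delta>3: "0 < \<delta> / 3" using assms by simp
  \<comment> \<open>For these t a point moved down by t has at least \<delta> / 3 of ray on both
    sides, so the same direction field serves all t.\<close>
  define I where "I = {\<delta> / 3 .. 2 * \<delta> / 3}"
  have I: "uncountable I" unfolding I_def using assms by (simp add: uncountable_closed_interval)
  have "\<exists>G. (\<forall>y p. ray (\<delta> / 3) (\<delta> / 3) y p \<longrightarrow> G y = y + t *\<^sub>R p) \<and>
      (1 + \<bar>t\<bar> / (\<delta> / 3))-lipschitz_on (ray_set (\<delta> / 3) (\<delta> / 3)) G" for t
    by (rule ray_flow[OF \<delta>3, of t]) blast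
  then obtain G where G: "\<And>t y p. ray (\<delta> / 3) (\<delta> / 3) y p \<Longrightarrow> G t y = y + t *\<^sub>R p"
    and lipG: "\<And>t. (1 + \<bar>t\<bar> / (\<delta> / 3))-lipschitz_on (ray_set (\<delta> / 3) (\<delta> / 3)) (G t)"
    by metis
  define Y where "Y t = {y \<in> ray_set t (\<delta> - t). G t y \<in> upper_ends \<delta>}" for t
  have sub: "ray (\<delta> / 3) (\<delta> / 3) y p" if "ray t (\<delta> - t) y p" "t \<in> I" for t y p
    using that assms by (auto simp: I_def intro!: ray_shrink[OF that(1)])
  have sub': "ray_set t (\<delta> - t) \<subseteq> ray_set (\<delta> / 3) (\<delta> / 3)" if "t \<in> I" for t
    using sub that unfolding ray_set_def by auto
  have [measurable]: "upper_ends \<delta> \<in> sets borel"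
    unfolding upper_ends_def by measurable
  have Y: "Y t \<in> sets borel" if t: "t \<in> I" for t
  proof -
    have "continuous_on (ray_set t (\<delta> - t)) (G t)"
      by (rule continuous_on_subset[OF lipschitz_on_continuous_on[OF lipG] sub'[OF t]])
    then have "G t \<in> borel_measurable (restrict_space borel (ray_set t (\<delta> - t)))"
      by (rule borel_measurable_continuous_on_restrict)
    then have "G t -` upper_ends \<delta> \<inter> ray_set t (\<delta> - t) \<in> sets (restrict_space borel (ray_set t (\<delta> - t)))"
      by (rule measurable_sets[THEN back_subst[of "\<lambda>A. A \<in> _"]]) (auto simp: space_restrict_space)
    then have "G t -` upper_ends \<delta> \<inter> ray_set t (\<delta> - t) \<in> sets borel"
      by (subst (asm) sets_restrict_space_iff) auto
    also have "G t -` upper_ends \<delta> \<inter> ray_set t (\<delta> - t) = Y t" by (auto simp: Y_def)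
    finally show ?thesis .
  qed
  \<comment> \<open>The point reached after going up by s still has t - s of ray above it, so it is
    not an upper end.\<close>
  have disj_less: False if st: "s \<in> I" "t \<in> I" "s < t" and y: "y \<in> Y s" "y \<in> Y t" for s t y
  proof -
    obtain p where p: "ray t (\<delta> - t) y p" using y(2) unfolding Y_def ray_set_def by auto
    have "G s y = y + s *\<^sub>R p" using G[OF sub[OF p st(2)]] .
    moreover have "ray (t - s) (\<delta> - t + s) (y + s *\<^sub>R p) p"
      using st assms by (intro ray_up p) (auto simp: I_def)
    then have "ray (t - s) 0 (y + s *\<^sub>R p) p"
      by (rule ray_shrink) (use st assms in \<open>auto simp: I_def\<close>)
    ultimately show False
      using upper_endsD[of "t - s" "y + s *\<^sub>R p" p \<delta>] st y(1) unfolding Y_def by simp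
  qed
  have disj: "disjoint_family_on Y I"
    unfolding disjoint_family_on_def using disj_less by (metis disjoint_iff linorder_neqE)
  have Ysub: "Y t \<subseteq> \<Omega>" for t using ray_set_subset by (auto simp: Y_def)
  have \<Omega>b: "\<Omega> \<in> sets borel" using compact by (intro borel_closed compact_imp_closed)
  \<comment> \<open>Lebesgue measure becomes finite on the compact \<open>\<Omega>\<close>, which
    contains all sets \<open>Y t\<close>.\<close>
  interpret R: finite_measure "restrict_space lborel \<Omega>"
    using \<Omega>b emeasure_compact_finite[OF compact]
    by (intro finite_measureI) (auto simp: emeasure_restrict_space space_restrict_space)
  obtain t where t: "t \<in> I" "Y t \<in> null_sets (restrict_space lborel \<Omega>)"
    using R.uncountable_disjoint_null_set[OF I disj] Y Ysub \<Omega>b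
    by (auto simp: sets_restrict_space_iff)
  then have "Y t \<in> null_sets lborel"
    using \<Omega>b by (simp add: null_sets_restrict_space)
  then have "negligible (Y t)"
    by (simp add: negligible_iff_null_sets null_sets_completionI)
  then have "negligible (G t ` Y t)"
    by (rule negligible_lipschitz_image[OF lipG]) (use sub'[OF t(1)] in \<open>auto simp: Y_def\<close>)
  then show ?thesis
  proof (rule negligible_subset, safe)
    fix x assume x: "x \<in> upper_ends \<delta>"
    then obtain p where p: "ray 0 \<delta> x p" unfolding upper_ends_def ray_set_def by auto
    have "ray (0 + t) (\<delta> - t) (x - t *\<^sub>R p) p"
      using t assms by (intro ray_down p) (auto simp: I_def)
    then have ray: "ray t (\<delta> - t) (x - t *\<^sub>R p) p" by simp
    then have "G t (x - t *\<^sub>R p) = x" using G[OF sub[OF ray t(1)], of t] by simp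
    with x ray show "x \<in> G t ` Y t"
      by (intro image_eqI[of _ _ "x - t *\<^sub>R p"]) (auto simp: Y_def ray_set_def)
  qed
qed

end

section \<open>Measurability of the descent step\<close>

lemma GDERIV_unique:
  fixes u :: "'a::euclidean_space \<Rightarrow> real"
  assumes "GDERIV u x :> D" "GDERIV u x :> D'"
  shows "D = D'"
proof -
  have "(\<lambda>h. h \<bullet> D) = (\<lambda>h. h \<bullet> D')"
    using assms unfolding gderiv_def by (rule has_derivative_unique)
  then have "(D - D') \<bullet> D = (D - D') \<bullet> D'" by meson
  then have "(D - D') \<bullet> (D - D') = 0" by (simp add: inner_diff_right)
  then show ?thesis by simp
qed

lemma GDERIV_iff_bound:
  fixes u :: "'a::euclidean_space \<Rightarrow> real"
  shows "GDERIV u x :> D \<longleftrightarrow>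
    (\<forall>e>0. \<exists>d>0. \<forall>h. norm h < d \<longrightarrow> \<bar>u (x + h) - u x - h \<bullet> D\<bar> \<le> e * norm h)"
proof -
  have "(\<forall>y. norm (y - x) < d \<longrightarrow> \<bar>u y - u x - (y - x) \<bullet> D\<bar> \<le> e * norm (y - x)) \<longleftrightarrow>
      (\<forall>h. norm h < d \<longrightarrow> \<bar>u (x + h) - u x - h \<bullet> D\<bar> \<le> e * norm h)" for d e
    by (metis add_diff_cancel_left' add.commute diff_add_cancel)
  then show ?thesis
    unfolding gderiv_def has_derivative_at_alt by (simp add: bounded_linear_inner_left)
qed

text \<open>
  A derivative is recognised by approximate gradients from a countable dense set: any two gradients that are
  accurate up to \<open>1 / m\<close> and \<open>1 / n\<close> differ by at most \<open>1 / m + 1 / n\<close>.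
\<close>

lemma GDERIV_exists_iff:
  fixes u :: "'a::euclidean_space \<Rightarrow> real"
  assumes dense: "closure Q = (UNIV :: 'a set)"
  shows "(\<exists>D. GDERIV u x :> D) \<longleftrightarrow>
    (\<forall>n::nat. \<exists>q\<in>Q. \<exists>m::nat. \<forall>h. norm h < 1 / Suc m \<longrightarrow> \<bar>u (x + h) - u x - h \<bullet> q\<bar> \<le> (1 / Suc n) * norm h)"
    (is "?L \<longleftrightarrow> ?R")
proof
  assume ?L
  then obtain D where D: "GDERIV u x :> D" ..
  show ?R
  proof
    fix n :: nat
    have "(1 / Suc n / 2 :: real) > 0" by simp
    then obtain d where d: "d > 0"
      "\<And>h. norm h < d \<Longrightarrow> \<bar>u (x + h) - u x - h \<bullet> D\<bar> \<le> 1 / Suc n / 2 * norm h"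
      using D unfolding GDERIV_iff_bound by meson
    obtain m where m: "1 / Suc m < d" using nat_approx_posE[OF d(1)] by blast
    have "D \<in> closure Q" using dense by simp
    then obtain q where q: "q \<in> Q" "dist q D < 1 / Suc n / 2"
      unfolding closure_approachable by (metis \<open>1 / Suc n / 2 > 0\<close>)
    have tri: "\<bar>b - c\<bar> \<le> r \<Longrightarrow> \<bar>a - b\<bar> \<le> r \<Longrightarrow> \<bar>a - c\<bar> \<le> r + r" for a b c r :: real
      by linarith
    have "\<bar>u (x + h) - u x - h \<bullet> q\<bar> \<le> (1 / Suc n) * norm h" if "norm h < 1 / Suc m" for h
    proof -
      have "\<bar>h \<bullet> (D - q)\<bar> \<le> norm h * norm (D - q)" by (rule Cauchy_Schwarz_ineq2)
      also have "\<dots> \<le> norm h * (1 / Suc n / 2)"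
        using q(2) by (intro mult_left_mono) (auto simp: dist_norm norm_minus_commute)
      finally have "\<bar>h \<bullet> D - h \<bullet> q\<bar> \<le> 1 / Suc n / 2 * norm h" by (simp add: inner_diff_right mult.commute)
      moreover have "\<bar>u (x + h) - u x - h \<bullet> D\<bar> \<le> 1 / Suc n / 2 * norm h" using that m by (intro d) simp
      ultimately have "\<bar>u (x + h) - u x - h \<bullet> q\<bar> \<le> 1 / Suc n / 2 * norm h + 1 / Suc n / 2 * norm h"
        by (rule tri)
      moreover have "a / 2 * b + a / 2 * b = a * b" for a b :: real by simp
      ultimately show ?thesis by (simp only:)
    qed
    with q(1) show "\<exists>q\<in>Q. \<exists>m::nat. \<forall>h. norm h < 1 / Suc m \<longrightarrow> \<bar>u (x + h) - u x - h \<bullet> q\<bar> \<le> (1 / Suc n) * norm h"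
      by blast
  qed
next
  assume ?R
  then obtain q m where qm: "\<And>n h. norm h < 1 / Suc (m n) \<Longrightarrow>
      \<bar>u (x + h) - u x - h \<bullet> q n\<bar> \<le> (1 / Suc n) * norm h" for n :: nat
    by metis
  have close: "norm (q k - q n) \<le> 1 / Suc k + 1 / Suc n" for k n
  proof (cases "q k = q n")
    case False
    define e where "e = q k - q n"
    have e: "norm e > 0" using False by (simp add: e_def)
    \<comment> \<open>The increment s e has half the smaller radius as its length; the direction e
      is where the two linear approximations differ most.\<close>
    define s where "s = min (1 / Suc (m k)) (1 / Suc (m n)) / (2 * norm e)"
    have s: "s > 0" using e by (simp add: s_def)
    have "s * norm e < 1 / Suc (m k)" "s * norm e < 1 / Suc (m n)"
      using e by (auto simp: s_def min_def field_simps)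
    then have "norm (s *\<^sub>R e) < 1 / Suc (m k)" "norm (s *\<^sub>R e) < 1 / Suc (m n)"
      using s by simp_all
    then have "\<bar>s *\<^sub>R e \<bullet> q k - s *\<^sub>R e \<bullet> q n\<bar> \<le> (1 / Suc k) * norm (s *\<^sub>R e) + (1 / Suc n) * norm (s *\<^sub>R e)"
      using qm[of "s *\<^sub>R e" k] qm[of "s *\<^sub>R e" n] by linarith
    moreover have "s *\<^sub>R e \<bullet> q k - s *\<^sub>R e \<bullet> q n = s * (norm e * norm e)"
    proof -
      have "e \<bullet> q k - e \<bullet> q n = e \<bullet> e" by (simp add: e_def inner_diff_right)
      also have "\<dots> = norm e * norm e" by (simp add: power2_norm_eq_inner[symmetric] power2_eq_square)
      finally show ?thesis by (simp flip: right_diff_distrib)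
    qed
    ultimately have "s * norm e * norm e \<le> s * norm e * (1 / Suc k + 1 / Suc n)"
      using s by (simp add: algebra_simps)
    then show ?thesis using s e unfolding e_def[symmetric] by (simp only: mult_le_cancel_left_pos mult_pos_pos)
  qed simp
  have inv0: "(\<lambda>n. 1 / real (Suc n)) \<longlonglongrightarrow> 0"
    using LIMSEQ_inverse_real_of_nat by (simp add: inverse_eq_divide)
  have "Cauchy q"
  proof (rule metric_CauchyI)
    fix e :: real assume "e > 0"
    then obtain N where N: "1 / Suc N < e / 2" using nat_approx_posE[of "e / 2"] by auto
    have "dist (q k) (q n) < e" if "k \<ge> N" "n \<ge> N" for k n
    proof -
      have "1 / Suc k \<le> 1 / Suc N" "1 / Suc n \<le> 1 / Suc N" using that by (auto simp: field_simps)
      then show ?thesis using close[of k n] N by (simp add: dist_norm)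
    qed
    then show "\<exists>N. \<forall>k\<ge>N. \<forall>n\<ge>N. dist (q k) (q n) < e" by blast
  qed
  then obtain D where D: "q \<longlonglongrightarrow> D" using Cauchy_convergent convergent_def by blast
  have qD: "norm (D - q n) \<le> 1 / Suc n" for n
  proof (rule LIMSEQ_le)
    show "(\<lambda>k. norm (q k - q n)) \<longlonglongrightarrow> norm (D - q n)" by (intro tendsto_intros D)
    show "(\<lambda>k. 1 / Suc k + 1 / Suc n) \<longlonglongrightarrow> 1 / Suc n"
      using tendsto_add[OF inv0 tendsto_const[of "1 / real (Suc n)"]] by simp
  qed (use close in blast)
  have "GDERIV u x :> D"
    unfolding GDERIV_iff_bound
  proof (intro allI impI)
    fix e :: real assume "e > 0"
    then obtain n where n: "1 / Suc n < e / 2" using nat_approx_posE[of "e / 2"] by auto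
    have "\<bar>u (x + h) - u x - h \<bullet> D\<bar> \<le> e * norm h" if "norm h < 1 / Suc (m n)" for h
    proof -
      have "\<bar>h \<bullet> (D - q n)\<bar> \<le> norm h * norm (D - q n)" by (rule Cauchy_Schwarz_ineq2)
      also have "\<dots> \<le> norm h * (1 / Suc n)" by (intro mult_left_mono qD) simp
      finally have "\<bar>h \<bullet> D - h \<bullet> q n\<bar> \<le> 1 / Suc n * norm h" by (simp add: inner_diff_right)
      then have "\<bar>u (x + h) - u x - h \<bullet> D\<bar> \<le> 1 / Suc n * norm h + 1 / Suc n * norm h"
        using qm[OF that] by linarith
      also have "\<dots> = (1 / Suc n + 1 / Suc n) * norm h" by (simp only: distrib_right)
      also have "\<dots> \<le> e * norm h" using n by (intro mult_right_mono) auto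
      finally show ?thesis .
    qed
    then show "\<exists>d>0. \<forall>h. norm h < d \<longrightarrow> \<bar>u (x + h) - u x - h \<bullet> D\<bar> \<le> e * norm h"
      by (intro exI[of _ "1 / Suc (m n)"]) simp
  qed
  then show ?L ..
qed

text \<open>For fixed n, q and m the condition quantifies over all h, but by continuity it is closed
  in x; the remaining quantifiers are countable.\<close>

lemma differentiability_set_borel:
  fixes u :: "'a::euclidean_space \<Rightarrow> real"
  assumes u: "continuous_on UNIV u"
  shows "{x. \<exists>D. GDERIV u x :> D} \<in> sets borel"
proof -
  obtain Q :: "'a set" where Q: "countable Q" "closure Q = UNIV"
    using separable[of "UNIV :: 'a set"] by (metis UNIV_eq_I closure_mono order_antisym subset_UNIV top.extremum_uniqueI)
  define C where "C n q m = {x. \<forall>h. norm h < 1 / Suc m \<longrightarrow> \<bar>u (x + h) - u x - h \<bullet> q\<bar> \<le> (1 / Suc n) * norm h}"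
    for n m :: nat and q
  have "closed (C n q m)" for n q m
    unfolding C_def
    by (intro closed_Collect_all closed_Collect_imp closed_Collect_le open_Collect_const continuous_intros
        continuous_on_compose2[OF u]) auto
  then have [measurable]: "C n q m \<in> sets borel" for n q m by (rule borel_closed)
  have "(\<Inter>n. \<Union>q\<in>Q. \<Union>m. C n q m) \<in> sets borel"
    using Q(1) by (intro sets.countable_INT' sets.countable_UN') auto
  also have "(\<Inter>n. \<Union>q\<in>Q. \<Union>m. C n q m) = {x. \<exists>D. GDERIV u x :> D}"
    unfolding GDERIV_exists_iff[OF Q(2)] C_def by auto
  finally show ?thesis .
qed

text \<open>Each component is a limit of difference quotients with steps 1 / (n + 1), cut off by the
  Borel set of differentiability.\<close>

lemma gradient_measurable:
  fixes u :: "'a::euclidean_space \<Rightarrow> real"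
  assumes u: "continuous_on UNIV u"
  shows "(\<lambda>x. if \<exists>D. GDERIV u x :> D then (THE D. GDERIV u x :> D) else 0) \<in> borel_measurable borel"
    (is "?g \<in> _")
proof -
  let ?S = "{x. \<exists>D. GDERIV u x :> D}"
  note differentiability_set_borel[OF u, measurable]
  have [measurable]: "u \<in> borel_measurable borel" using u by (rule borel_measurable_continuous_onI)
  have "(\<lambda>x. ?g x \<bullet> b) \<in> borel_measurable borel" for b
  proof (rule borel_measurable_LIMSEQ_real)
    define f where "f n x = indicator ?S x * ((u (x + (1 / Suc n) *\<^sub>R b) - u x) * Suc n)" for n x
    show "(f n) \<in> borel_measurable borel" for n
      unfolding f_def by measurable
    show "(\<lambda>n. f n x) \<longlonglongrightarrow> ?g x \<bullet> b" for x
    proof (cases "x \<in> ?S")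
      case True
      then obtain D where D: "GDERIV u x :> D" by auto
      then have g: "?g x = D" using GDERIV_unique by (auto intro!: the_equality)
      have "((\<lambda>t. x + t *\<^sub>R b) has_derivative (\<lambda>t. t *\<^sub>R b)) (at 0)"
        by (auto intro!: derivative_eq_intros)
      moreover have "(u has_derivative (\<lambda>h. h \<bullet> D)) (at (x + 0 *\<^sub>R b))"
        using D by (simp add: gderiv_def)
      ultimately have "((\<lambda>t. u (x + t *\<^sub>R b)) has_derivative (\<lambda>t. (t *\<^sub>R b) \<bullet> D)) (at 0)"
        by (rule has_derivative_compose)
      then have "((\<lambda>t. u (x + t *\<^sub>R b)) has_field_derivative (b \<bullet> D)) (at 0)"
        by (simp add: has_field_derivative_def mult_commute_abs)
      then have "((\<lambda>t. (u (x + t *\<^sub>R b) - u x) / t) \<longlongrightarrow> b \<bullet> D) (at 0)"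
        by (simp add: DERIV_def)
      moreover have "filterlim (\<lambda>n. 1 / real (Suc n)) (at 0) sequentially"
        using LIMSEQ_inverse_real_of_nat by (simp add: inverse_eq_divide filterlim_at)
      ultimately have "(\<lambda>n. (u (x + (1 / Suc n) *\<^sub>R b) - u x) / (1 / Suc n)) \<longlonglongrightarrow> b \<bullet> D"
        by (rule filterlim_compose)
      then show ?thesis unfolding g f_def using True by (simp add: inner_commute)
    qed (simp add: f_def)
  qed
  then show ?thesis by (subst borel_measurable_euclidean_space) blast
qed

section \<open>Independence of the values outside the domain\<close>

lemma GDERIV_transform_open:
  assumes "open S" "x \<in> S" "\<And>y. y \<in> S \<Longrightarrow> u y = v y" "GDERIV u x :> D"
  shows "GDERIV v x :> D"
  using assms(4) unfolding gderiv_def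
  by (rule has_derivative_transform_within_open) (use assms in auto)

text \<open>Gradients are taken at interior points only. Hence a potential given on
  \<open>\<Omega>\<close> may be replaced by a global 1-Lipschitz extension, to which the ray
  estimates apply.\<close>

lemma descent_step_cong:
  assumes "\<And>x. x \<in> \<Omega> \<Longrightarrow> u x = v x"
  shows "descent_step \<Omega> \<eta> u = descent_step \<Omega> \<eta> v"
proof
  fix x
  have "gderiv u x = gderiv v x" if "x \<in> interior \<Omega>"
    using GDERIV_transform_open[of "interior \<Omega>" x u v] GDERIV_transform_open[of "interior \<Omega>" x v u]
      assms interior_subset[of \<Omega>] that by (intro ext) (auto simp: subset_eq)
  then show "descent_step \<Omega> \<eta> u x = descent_step \<Omega> \<eta> v x"
    unfolding descent_step_def by (cases "x \<in> interior \<Omega>") (simp_all, blast)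
qed

text \<open>Composition with the nearest-point projection, which is 1-Lipschitz for a closed convex
  set.\<close>

lemma lipschitz_extension:
  fixes u :: "'a::euclidean_space \<Rightarrow> real"
  assumes "convex \<Omega>" "closed \<Omega>" "\<Omega> \<noteq> {}" "1-lipschitz_on \<Omega> u"
  obtains v where "1-lipschitz_on UNIV v" "\<And>x. x \<in> \<Omega> \<Longrightarrow> v x = u x"
proof (rule that[of "\<lambda>x. u (closest_point \<Omega> x)"])
  show "1-lipschitz_on UNIV (\<lambda>x. u (closest_point \<Omega> x))"
  proof (rule lipschitz_onI)
    fix x y
    have "dist (u (closest_point \<Omega> x)) (u (closest_point \<Omega> y)) \<le> 1 * dist (closest_point \<Omega> x) (closest_point \<Omega> y)"
      using assms by (intro lipschitz_onD[OF assms(4)] closest_point_in_set)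
    also have "\<dots> \<le> 1 * dist x y"
      using closest_point_lipschitz[OF assms(1-3)] by simp
    finally show "dist (u (closest_point \<Omega> x)) (u (closest_point \<Omega> y)) \<le> 1 * dist x y" .
  qed simp
  show "u (closest_point \<Omega> x) = u x" if "x \<in> \<Omega>" for x
    using that by (simp add: closest_point_self)
qed

lemma descent_step_measurable:
  fixes u :: "'a::euclidean_space \<Rightarrow> real"
  assumes "continuous_on UNIV u"
  shows "descent_step \<Omega> \<eta> u \<in> borel_measurable borel"
proof -
  note gradient_measurable[OF assms, measurable] differentiability_set_borel[OF assms, measurable]
  have "descent_step \<Omega> \<eta> u = (\<lambda>x. x - (if x \<in> interior \<Omega> then \<eta> else 0) *\<^sub>R
      (if \<exists>D. GDERIV u x :> D then (THE D. GDERIV u x :> D) else 0))"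
    by (rule ext) (simp add: descent_step_def, blast)
  moreover have "interior \<Omega> \<in> sets borel" by simp
  ultimately show ?thesis by simp
qed

lemma descent_step_GDERIV:
  assumes "x \<in> interior \<Omega>" "GDERIV u x :> D"
  shows "descent_step \<Omega> \<eta> u x = x - \<eta> *\<^sub>R D"
proof -
  have "(THE D. GDERIV u x :> D) = D" using assms(2) GDERIV_unique by blast
  then show ?thesis using assms unfolding descent_step_def by auto
qed

section \<open>The iteration\<close>

lemma prob_measures_onD:
  assumes "\<kappa> \<in> prob_measures_on \<Omega>" "\<Omega> \<in> sets borel"
  shows "prob_space \<kappa>" "sets \<kappa> = sets borel" "space \<kappa> = UNIV" "AE x in \<kappa>. x \<in> \<Omega>"
proof -
  show 1: "prob_space \<kappa>" and 2: "sets \<kappa> = sets borel"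
    using assms(1) by (auto simp: prob_measures_on_def)
  show 3: "space \<kappa> = UNIV" using sets_eq_imp_space_eq[OF 2] by simp
  interpret prob_space \<kappa> by fact
  have "emeasure \<kappa> \<Omega> = 1" using assms(1) by (auto simp: prob_measures_on_def)
  then have "prob \<Omega> = 1" by (simp add: emeasure_eq_measure)
  then show "AE x in \<kappa>. x \<in> \<Omega>" using assms(2) 2 by (simp add: prob_eq_1)
qed

lemma prob_measures_onI:
  assumes "prob_space \<kappa>" "sets \<kappa> = sets borel" "\<Omega> \<in> sets borel" "AE x in \<kappa>. x \<in> \<Omega>"
  shows "\<kappa> \<in> prob_measures_on \<Omega>"
proof -
  interpret prob_space \<kappa> by fact
  have "prob \<Omega> = 1" using assms by (simp add: prob_eq_1)
  then show ?thesis using assms by (simp add: prob_measures_on_def emeasure_eq_measure)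
qed

lemma set_integral_full:
  fixes f :: "'a::topological_space \<Rightarrow> real"
  assumes "f \<in> borel_measurable \<kappa>" "\<Omega> \<in> sets \<kappa>" "AE x in \<kappa>. x \<in> \<Omega>"
  shows "(LINT x:\<Omega>|\<kappa>. f x) = (LINT x|\<kappa>. f x)"
  unfolding set_lebesgue_integral_def
  using assms by (intro integral_cong_AE) (auto elim!: eventually_mono)

lemma set_integral_eq_on:
  assumes "\<And>x. x \<in> \<Omega> \<Longrightarrow> f x = g x"
  shows "(LINT x:\<Omega>|\<kappa>. f x) = (LINT x:\<Omega>|\<kappa>. g x)"
  unfolding set_lebesgue_integral_def
  using assms by (intro Bochner_Integration.integral_cong) (auto simp: indicator_def)

lemma kantorovich_potential_cong:
  assumes "\<And>x. x \<in> \<Omega> \<Longrightarrow> u x = w x"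
  shows "kantorovich_potential \<Omega> \<mu> \<nu> u \<longleftrightarrow> kantorovich_potential \<Omega> \<mu> \<nu> w"
proof -
  have "1-lipschitz_on \<Omega> u \<longleftrightarrow> 1-lipschitz_on \<Omega> w"
    using assms unfolding lipschitz_on_def by auto
  then show ?thesis
    unfolding kantorovich_potential_def
    using set_integral_eq_on[of \<Omega> u w \<mu>] set_integral_eq_on[of \<Omega> u w \<nu>] assms by simp
qed

text \<open>Passes between transport maps, given on \<open>\<Omega>\<close> only, and Borel maps of
  the whole space.\<close>

lemma distr_restrict_full:
  assumes \<mu>: "sets \<mu> = sets borel" "\<Omega> \<in> sets borel" "AE x in \<mu>. x \<in> \<Omega>"
    and S: "S \<in> borel_measurable borel" and eq: "\<And>x. x \<in> \<Omega> \<Longrightarrow> S' x = S x"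
  shows "distr (restrict_space \<mu> \<Omega>) borel S' = distr \<mu> borel S"
proof -
  have sp: "space \<mu> = UNIV" using sets_eq_imp_space_eq[OF \<mu>(1)] by simp
  note [measurable_cong] = \<mu>(1)
  note S [measurable] \<mu>(2) [measurable]
  have "distr (restrict_space \<mu> \<Omega>) borel S' = distr (restrict_space \<mu> \<Omega>) borel S"
    using eq by (intro distr_cong) (auto simp: space_restrict_space)
  also have "\<dots> = distr \<mu> borel S"
  proof (rule measure_eqI)
    fix E assume "E \<in> sets (distr (restrict_space \<mu> \<Omega>) borel S)"
    then have E [measurable]: "E \<in> sets borel" by simp
    have SE: "S -` E \<in> sets borel" using measurable_sets[OF S E] by simp
    have "S \<in> borel_measurable (restrict_space \<mu> \<Omega>)"
      by (rule measurable_restrict_space1) measurable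
    then have "emeasure (distr (restrict_space \<mu> \<Omega>) borel S) E = emeasure (restrict_space \<mu> \<Omega>) (S -` E \<inter> \<Omega>)"
      using E sp by (simp add: emeasure_distr space_restrict_space)
    also have "\<dots> = emeasure \<mu> (S -` E \<inter> \<Omega>)"
      using \<mu> sp by (intro emeasure_restrict_space) auto
    also have "\<dots> = emeasure \<mu> (S -` E)"
      using \<mu>(3) SE by (intro emeasure_eq_AE) (auto elim!: eventually_mono simp: \<mu>(1))
    finally show "emeasure (distr (restrict_space \<mu> \<Omega>) borel S) E = emeasure (distr \<mu> borel S) E"
      using sp E by (simp add: emeasure_distr)
  qed simp
  finally show ?thesis .
qed

text \<open>A negligible set need not be Borel, hence the passage to a Borel null cover
  \<open>N\<close>.\<close>

lemma AE_not_in_negligible: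
  assumes "absolutely_continuous lborel \<mu>" "negligible E"
  shows "AE x in \<mu>. x \<notin> E"
proof -
  have "E \<in> null_sets (completion lborel)"
    using assms(2) by (simp add: negligible_iff_null_sets)
  then obtain N where "N \<in> null_sets lborel" "E \<subseteq> N"
    by (auto simp: null_sets_completion_iff2)
  then have "N \<in> null_sets \<mu>" using assms(1) by (auto simp: absolutely_continuous_def)
  then have "AE x in \<mu>. x \<notin> N" by (rule AE_not_in)
  then show ?thesis by eventually_elim (use \<open>E \<subseteq> N\<close> in blast)
qed

lemma scaleR_norm_sgn: "norm x *\<^sub>R sgn x = (x :: 'a::real_normed_vector)"
  by (cases "x = 0") (simp_all add: sgn_div_norm)

text \<open>Optimality of \<open>T\<close> enters through the dual certificate \<open>v\<close>,
  which has slope 1 along almost every transport segment.\<close>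

locale optimal_transport =
  fixes \<Omega> :: "'a::euclidean_space set" and \<mu> \<nu> :: "'a measure" and T :: "'a \<Rightarrow> 'a" and v :: "'a \<Rightarrow> real"
  assumes compact: "compact \<Omega>" and convex: "convex \<Omega>"
    and \<mu>: "\<mu> \<in> prob_measures_on \<Omega>" and \<nu>: "\<nu> \<in> prob_measures_on \<Omega>"
    and ac: "absolutely_continuous lborel \<mu>"
    and T [measurable]: "T \<in> borel_measurable borel" and T_in: "T x \<in> \<Omega>"
    and T_push: "distr \<mu> borel T = \<nu>"
    and v_lip: "1-lipschitz_on UNIV v" and v_slope: "AE x in \<mu>. v x - v (T x) = norm (x - T x)"
begin

sublocale M: prob_space \<mu>
  using \<mu> by (simp add: prob_measures_on_def)

lemma \<Omega>_borel [measurable]: "\<Omega> \<in> sets borel"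
  using compact by (intro borel_closed compact_imp_closed)

lemma sets_\<mu> [measurable_cong, simp]: "sets \<mu> = sets borel"
  and space_\<mu> [simp]: "space \<mu> = UNIV" and AE_\<Omega>: "AE x in \<mu>. x \<in> \<Omega>"
  using prob_measures_onD[OF \<mu> \<Omega>_borel] by auto

lemma prob_UNIV [simp]: "measure \<mu> UNIV = 1"
  using M.prob_space by simp

lemma lipschitz_integrable:
  fixes w :: "'a \<Rightarrow> real"
  assumes \<kappa>: "prob_space \<kappa>" and f [measurable]: "f \<in> borel_measurable \<kappa>" "AE x in \<kappa>. f x \<in> \<Omega>"
    and w: "1-lipschitz_on UNIV w"
  shows "integrable \<kappa> (\<lambda>x. w (f x))"
proof -
  interpret prob_space \<kappa> by fact
  have cont: "continuous_on UNIV w" by (rule lipschitz_on_continuous_on[OF w])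
  then have [measurable]: "w \<in> borel_measurable borel" by (rule borel_measurable_continuous_onI)
  have "bounded (w ` \<Omega>)"
    using compact cont by (intro compact_imp_bounded compact_continuous_image) (auto intro: continuous_on_subset)
  then obtain B where "\<And>x. x \<in> \<Omega> \<Longrightarrow> norm (w x) \<le> B" unfolding bounded_iff by blast
  then show ?thesis
    using f(2) by (intro integrable_const_bound[where B=B]) (auto elim!: eventually_mono)
qed

lemma displacement_integrable:
  assumes \<kappa>: "prob_space \<kappa>" and [measurable]: "f \<in> borel_measurable \<kappa>" "g \<in> borel_measurable \<kappa>"
    and "AE x in \<kappa>. f x \<in> \<Omega>" "AE x in \<kappa>. g x \<in> \<Omega>"
  shows "integrable \<kappa> (\<lambda>x. norm (f x - g x))"
proof -
  interpret prob_space \<kappa> by fact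
  obtain b where b: "\<And>x y. x \<in> \<Omega> \<Longrightarrow> y \<in> \<Omega> \<Longrightarrow> dist x y \<le> b"
    using compact_imp_bounded[OF compact] bounded_two_points by metis
  have "AE x in \<kappa>. norm (norm (f x - g x)) \<le> b"
    using assms(4,5) by eventually_elim (use b in \<open>auto simp: dist_norm\<close>)
  then show ?thesis by (intro integrable_const_bound[where B=b]) auto
qed

lemma set_integral_push:
  fixes w :: "'a \<Rightarrow> real"
  assumes F [measurable]: "F \<in> borel_measurable borel" and F_in: "AE x in \<mu>. F x \<in> \<Omega>"
    and w: "1-lipschitz_on UNIV w"
  shows "(LINT x:\<Omega>|distr \<mu> borel F. w x) = (LINT x|\<mu>. w (F x))"
proof -
  have [measurable]: "w \<in> borel_measurable borel"
    by (rule borel_measurable_continuous_onI[OF lipschitz_on_continuous_on[OF w]])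
  have "(LINT x:\<Omega>|distr \<mu> borel F. w x) = (LINT x|distr \<mu> borel F. w x)"
    using F_in by (intro set_integral_full) (auto simp: AE_distr_iff)
  then show ?thesis by (simp add: integral_distr)
qed

text \<open>The joint law of \<open>F\<close> and \<open>T\<close> is a coupling with this cost.
  Integrating the Lipschitz bound for \<open>v\<close> against any other coupling shows that its
  cost is no smaller, so the infimum is attained.\<close>

lemma W1_push:
  assumes F [measurable]: "F \<in> borel_measurable borel" and F_in: "AE x in \<mu>. F x \<in> \<Omega>"
    and slope: "AE x in \<mu>. v (F x) - v (T x) = norm (F x - T x)"
  shows "W1 \<Omega> (distr \<mu> borel F) \<nu> = (LINT x|\<mu>. norm (F x - T x))"
  unfolding W1_def
proof (rule cInf_eq_minimum)
  let ?c = "\<lambda>z::'a \<times> 'a. norm (fst z - snd z)"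
  have [measurable]: "v \<in> borel_measurable borel"
    by (rule borel_measurable_continuous_onI[OF lipschitz_on_continuous_on[OF v_lip]])
  have \<Omega>2: "\<Omega> \<times> \<Omega> \<in> sets borel"
    using compact by (intro borel_closed compact_imp_closed compact_Times)
  have c_meas: "?c \<in> borel_measurable borel"
    by (intro borel_measurable_continuous_onI continuous_intros)
  have fst_snd: "fst \<in> borel_measurable (borel :: ('a \<times> 'a) measure)"
      "snd \<in> borel_measurable (borel :: ('a \<times> 'a) measure)"
    by (intro borel_measurable_continuous_onI continuous_intros)+
  define \<gamma> where "\<gamma> = distr \<mu> borel (\<lambda>x. (F x, T x))"
  have FT [measurable]: "(\<lambda>x. (F x, T x)) \<in> borel_measurable borel" by measurable
  have \<gamma>_AE: "AE z in \<gamma>. z \<in> \<Omega> \<times> \<Omega>"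
    unfolding \<gamma>_def using F_in \<Omega>2 T_in by (subst AE_distr_iff) auto
  have "\<gamma> \<in> prob_measures_on (\<Omega> \<times> \<Omega>)"
    using \<gamma>_AE \<Omega>2 unfolding \<gamma>_def by (intro prob_measures_onI M.prob_space_distr) auto
  moreover have "distr \<gamma> borel fst = distr \<mu> borel F" "distr \<gamma> borel snd = \<nu>"
    unfolding \<gamma>_def using fst_snd by (simp_all add: distr_distr comp_def T_push)
  ultimately have "\<gamma> \<in> couplings \<Omega> (distr \<mu> borel F) \<nu>" by (simp add: couplings_def)
  moreover have "(LINT z:\<Omega> \<times> \<Omega>|\<gamma>. ?c z) = (LINT x|\<mu>. norm (F x - T x))"
  proof -
    have "(LINT z:\<Omega> \<times> \<Omega>|\<gamma>. ?c z) = (LINT z|\<gamma>. ?c z)"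
      using \<gamma>_AE \<Omega>2 c_meas by (intro set_integral_full) (auto simp: \<gamma>_def)
    also have "\<dots> = (LINT x|\<mu>. norm (F x - T x))"
      unfolding \<gamma>_def using c_meas by (subst integral_distr) auto
    finally show ?thesis .
  qed
  ultimately show "(LINT x|\<mu>. norm (F x - T x)) \<in>
      (\<lambda>\<gamma>. LINT z:\<Omega> \<times> \<Omega>|\<gamma>. ?c z) ` couplings \<Omega> (distr \<mu> borel F) \<nu>"
    by force
  fix y assume "y \<in> (\<lambda>\<gamma>. LINT z:\<Omega> \<times> \<Omega>|\<gamma>. ?c z) ` couplings \<Omega> (distr \<mu> borel F) \<nu>"
  then obtain \<kappa> where \<kappa>: "\<kappa> \<in> couplings \<Omega> (distr \<mu> borel F) \<nu>" and y: "y = (LINT z:\<Omega> \<times> \<Omega>|\<kappa>. ?c z)"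
    by auto
  then have \<kappa>P: "\<kappa> \<in> prob_measures_on (\<Omega> \<times> \<Omega>)"
    and marg: "distr \<kappa> borel fst = distr \<mu> borel F" "distr \<kappa> borel snd = \<nu>"
    by (auto simp: couplings_def)
  note \<kappa>D = prob_measures_onD[OF \<kappa>P \<Omega>2]
  note [measurable_cong] = \<kappa>D(2)
  have m [measurable]: "fst \<in> borel_measurable \<kappa>" "snd \<in> borel_measurable \<kappa>" "?c \<in> borel_measurable \<kappa>"
    using fst_snd c_meas by (simp_all cong: measurable_cong_sets add: measurable_cong_sets[OF \<kappa>D(2) refl])
  have in\<Omega>: "AE z in \<kappa>. fst z \<in> \<Omega>" "AE z in \<kappa>. snd z \<in> \<Omega>"
    using \<kappa>D(4) by (auto elim!: eventually_mono)
  note int = lipschitz_integrable[OF \<kappa>D(1) m(1) in\<Omega>(1) v_lip] lipschitz_integrable[OF \<kappa>D(1) m(2) in\<Omega>(2) v_lip]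
  have "(LINT x|\<mu>. norm (F x - T x)) = (LINT x|\<mu>. v (F x) - v (T x))"
    using slope by (intro integral_cong_AE) (auto elim!: eventually_mono)
  also have "\<dots> = (LINT x|\<mu>. v (F x)) - (LINT x|\<mu>. v (T x))"
    by (intro Bochner_Integration.integral_diff lipschitz_integrable M.prob_space_axioms v_lip) (auto simp: F_in T_in)
  also have "(LINT x|\<mu>. v (F x)) = (LINT z|\<kappa>. v (fst z))"
  proof -
    have "(LINT x|\<mu>. v (F x)) = (LINT x|distr \<mu> borel F. v x)" by (simp add: integral_distr)
    then show ?thesis by (simp add: integral_distr flip: marg(1))
  qed
  also have "(LINT x|\<mu>. v (T x)) = (LINT z|\<kappa>. v (snd z))"
  proof -
    have "(LINT x|\<mu>. v (T x)) = (LINT x|distr \<mu> borel T. v x)" by (simp add: integral_distr)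
    then show ?thesis unfolding T_push by (simp add: integral_distr flip: marg(2))
  qed
  also have "(LINT z|\<kappa>. v (fst z)) - (LINT z|\<kappa>. v (snd z)) = (LINT z|\<kappa>. v (fst z) - v (snd z))"
    by (rule Bochner_Integration.integral_diff[symmetric, OF int])
  also have "\<dots> \<le> (LINT z|\<kappa>. ?c z)"
  proof (rule integral_mono)
    show "v (fst z) - v (snd z) \<le> ?c z" for z
      using lipschitz_onD[OF v_lip, of "fst z" "snd z"] by (auto simp: dist_norm)
  qed (auto intro!: int displacement_integrable \<kappa>D(1) in\<Omega>)
  also have "\<dots> = y"
    unfolding y using \<kappa>D \<Omega>2 m(3) by (intro set_integral_full[symmetric]) auto
  finally show "(LINT x|\<mu>. norm (F x - T x)) \<le> y" .
qed

text \<open>Complementary slackness: the deficit \<open>g\<close> of \<open>w\<close> is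
  nonnegative, and since the competitor \<open>v\<close> attains the cost, maximality of
  \<open>w\<close> makes the integral of \<open>g\<close> vanish.\<close>

lemma potential_slope:
  assumes F [measurable]: "F \<in> borel_measurable borel" and F_in: "AE x in \<mu>. F x \<in> \<Omega>"
    and slope: "AE x in \<mu>. v (F x) - v (T x) = norm (F x - T x)"
    and w: "1-lipschitz_on UNIV w" and pot: "kantorovich_potential \<Omega> (distr \<mu> borel F) \<nu> w"
  shows "AE x in \<mu>. w (F x) - w (T x) = norm (F x - T x)"
proof -
  have T_in': "AE x in \<mu>. T x \<in> \<Omega>" by (simp add: T_in)
  have int: "integrable \<mu> (\<lambda>x. f (F x))" "integrable \<mu> (\<lambda>x. f (T x))" if "1-lipschitz_on UNIV f" for f :: "'a \<Rightarrow> real"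
    by (auto intro!: lipschitz_integrable M.prob_space_axioms F_in T_in' that)
  have dual: "(LINT x:\<Omega>|distr \<mu> borel F. f x) - (LINT x:\<Omega>|\<nu>. f x) = (LINT x|\<mu>. f (F x) - f (T x))"
    if "1-lipschitz_on UNIV f" for f :: "'a \<Rightarrow> real"
    using set_integral_push[OF F F_in that] set_integral_push[OF T T_in' that] int[OF that]
    by (simp add: T_push)
  define g where "g x = norm (F x - T x) - (w (F x) - w (T x))" for x
  have intn: "integrable \<mu> (\<lambda>x. norm (F x - T x))"
    by (intro displacement_integrable M.prob_space_axioms F_in T_in') auto
  have intg: "integrable \<mu> g"
    unfolding g_def by (intro Bochner_Integration.integrable_diff intn int w)
  have g_nonneg: "0 \<le> g x" for x
    using lipschitz_onD[OF w, of "F x" "T x"] by (auto simp: g_def dist_norm)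
  have "(LINT x|\<mu>. norm (F x - T x)) = (LINT x|\<mu>. v (F x) - v (T x))"
    using slope int[OF v_lip] intn by (intro integral_cong_AE) (auto elim!: eventually_mono)
  also have "\<dots> \<le> (LINT x|\<mu>. w (F x) - w (T x))"
    using pot lipschitz_on_subset[OF v_lip] unfolding kantorovich_potential_def dual[OF v_lip, symmetric] dual[OF w, symmetric]
    by blast
  finally have "(LINT x|\<mu>. g x) \<le> 0"
    unfolding g_def using intn int[OF w] by simp
  moreover have "0 \<le> (LINT x|\<mu>. g x)"
    by (rule integral_nonneg_AE) (simp add: g_nonneg)
  ultimately have "(LINT x|\<mu>. g x) = 0" by (rule antisym)
  then have "AE x in \<mu>. g x = 0"
    using integral_nonneg_eq_0_iff_AE[OF intg] g_nonneg by simp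
  then show ?thesis by eventually_elim (simp add: g_def)
qed

end

text \<open>\<open>l\<close> is an essential lower bound of the displacement, later taken above the
  distance travelled. Its positivity makes \<open>sgn (x - T x)\<close> a unit vector almost
  everywhere.\<close>

locale separated_transport = optimal_transport +
  fixes l :: real
  assumes l_pos: "0 < l" and l_le: "AE x in \<mu>. l \<le> norm (x - T x)"
begin

sublocale V: ray_domain \<Omega> v
  by standard (rule compact convex v_lip)+

abbreviation dir :: "'a \<Rightarrow> 'a" where
  "dir x \<equiv> sgn (x - T x)"

lemma AE_ray: "AE x in \<mu>. V.ray 0 (norm (x - T x)) x (dir x) \<and> l \<le> norm (x - T x)"
  using AE_\<Omega> v_slope l_le
proof eventually_elim
  case (elim x)
  have "x - norm (x - T x) *\<^sub>R dir x = T x" by (simp add: scaleR_norm_sgn)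
  moreover have "0 < norm (x - T x)" using elim l_pos by linarith
  then have "norm (dir x) = 1" by (simp add: norm_sgn)
  ultimately show ?case
    using elim T_in[of x] by (simp add: V.ray_def)
qed

lemma moved_point:
  assumes ray: "V.ray 0 (norm (x - T x)) x (dir x)" and a: "0 \<le> a" "a < l" "l \<le> norm (x - T x)"
    and y: "y = x - a *\<^sub>R dir x"
  shows "y \<in> \<Omega>" "y - T x = (norm (x - T x) - a) *\<^sub>R dir x" "norm (y - T x) = norm (x - T x) - a"
    "v y - v (T x) = norm (y - T x)" "norm (dir x) = 1"
proof -
  let ?n = "norm (x - T x)"
  have n: "norm (dir x) = 1" using ray by (simp add: V.ray_def)
  then show "norm (dir x) = 1" .
  have "V.ray (0 + a) (?n - a) y (dir x)"
    unfolding y using a by (intro V.ray_down ray) auto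
  moreover have Tx: "x - ?n *\<^sub>R dir x = T x" by (simp add: scaleR_norm_sgn)
  have yT: "y - (?n - a) *\<^sub>R dir x = T x"
    unfolding y using Tx by (simp add: algebra_simps)
  ultimately have "y \<in> \<Omega>" "v (T x) = v y - (?n - a)"
    unfolding V.ray_def by auto
  moreover show eq: "y - T x = (?n - a) *\<^sub>R dir x" using yT by (simp add: algebra_simps)
  moreover show "norm (y - T x) = ?n - a" unfolding eq using n a by simp
  ultimately show "y \<in> \<Omega>" "v y - v (T x) = norm (y - T x)" by auto
qed

text \<open>\<open>F\<close> stands for the composition of the steps made so far and
  \<open>a\<close> for the length travelled. The formula holds only almost everywhere, as a step
  leaves points without gradient in place.\<close>

context
  fixes F :: "'a \<Rightarrow> 'a" and a :: real
  assumes F [measurable]: "F \<in> borel_measurable borel" and a: "0 \<le> a" "a < l"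
    and F_eq: "AE x in \<mu>. F x = x - a *\<^sub>R dir x"
begin

lemma AE_F:
  "AE x in \<mu>. F x \<in> \<Omega> \<and> F x - T x = (norm (x - T x) - a) *\<^sub>R dir x \<and>
     norm (F x - T x) = norm (x - T x) - a \<and> v (F x) - v (T x) = norm (F x - T x) \<and>
     norm (dir x) = 1 \<and> l \<le> norm (x - T x)"
  using AE_ray F_eq
proof eventually_elim
  case (elim x)
  then show ?case using moved_point[of x a "F x"] a by simp
qed

lemma F_in: "AE x in \<mu>. F x \<in> \<Omega>" and F_slope: "AE x in \<mu>. v (F x) - v (T x) = norm (F x - T x)"
  using AE_F by (auto elim!: eventually_mono)

lemma W1_moved: "W1 \<Omega> (distr \<mu> borel F) \<nu> = (LINT x|\<mu>. norm (x - T x)) - a"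
proof -
  have "W1 \<Omega> (distr \<mu> borel F) \<nu> = (LINT x|\<mu>. norm (F x - T x))"
    by (rule W1_push[OF F F_in F_slope])
  also have "\<dots> = (LINT x|\<mu>. norm (x - T x) - a)"
    using AE_F by (intro integral_cong_AE) (auto elim!: eventually_mono)
  also have "\<dots> = (LINT x|\<mu>. norm (x - T x)) - a"
    using displacement_integrable[OF M.prob_space_axioms, of "\<lambda>x. x" T] AE_\<Omega> T_in
    by (subst Bochner_Integration.integral_diff) auto
  finally show ?thesis .
qed

text \<open>Absolute continuity of the moved measure, in a form that also covers negligible sets
  that are not Borel.\<close>

lemma AE_moved_not_in:
  assumes E: "negligible E"
  shows "AE x in \<mu>. F x \<notin> E"
\<comment> \<open>Without motion there need be no ray above x, so absolute continuity of
  \<open>\<mu>\<close> is used directly.\<close>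
proof (cases "a = 0")
  case True
  show ?thesis
    using F_eq AE_not_in_negligible[OF ac E] by eventually_elim (simp add: True)
next
  case False
  \<comment> \<open>The slack l - a is the length of ray that is left below almost every moved
    point.\<close>
  then have "negligible {x. \<exists>p. V.ray 0 (a + (l - a)) x p \<and> x - a *\<^sub>R p \<in> E}"
    using a by (intro V.negligible_descent_preimage E) auto
  from AE_not_in_negligible[OF ac this] F_eq AE_ray
  show ?thesis
  proof eventually_elim
    case (elim x)
    have "V.ray 0 (a + (l - a)) x (dir x)"
      using elim a by (auto intro: V.ray_shrink[of 0 "norm (x - T x)"])
    then show ?case using elim by auto
  qed
qed

lemma descent_step_moved:
  assumes w: "1-lipschitz_on UNIV w" and slope: "AE x in \<mu>. w (F x) - w (T x) = norm (F x - T x)"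
  shows "AE x in \<mu>. descent_step \<Omega> \<eta> w (F x) = x - (a + \<eta>) *\<^sub>R dir x"
proof -
  interpret R: ray_domain \<Omega> w
    by standard (rule compact convex w)+
  have "AE x in \<mu>. \<forall>n. F x \<notin> R.upper_ends (1 / Suc n)"
    unfolding AE_all_countable by (intro allI AE_moved_not_in R.negligible_upper_ends) simp
  \<comment> \<open>A descent step is the identity off the interior, so boundary points must be
    excluded; the frontier of a convex set is null.\<close>
  moreover have "AE x in \<mu>. F x \<notin> frontier \<Omega>"
    by (intro AE_moved_not_in negligible_convex_frontier convex)
  ultimately show ?thesis
    using AE_F F_eq slope
  proof eventually_elim
    case (elim x)
    define t where "t = norm (x - T x) - a"
    have t: "0 < t" using elim a by (simp add: t_def)
    have Tx: "F x - t *\<^sub>R dir x = T x" using elim by (simp add: t_def algebra_simps)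
    have ray: "R.ray 0 t (F x) (dir x)"
      using elim T_in[of x] a unfolding R.ray_def Tx by (simp add: t_def)
    obtain n where n: "1 / Suc n < t" using nat_approx_posE[OF t] by metis
    have ray': "R.ray 0 (1 / Suc n) (F x) (dir x)"
      using n by (intro R.ray_shrink[OF ray]) auto
    then have "F x \<in> R.ray_set 0 (1 / Suc n)" unfolding R.ray_set_def by blast
    with elim obtain m q where up: "R.ray (1 / Suc m) 0 (F x) q"
      unfolding R.upper_ends_def R.ray_set_def by blast
    \<comment> \<open>Not being an upper end yields an upward ray of unknown direction q; joining it
      with the ray down to \<open>T x\<close> forces q to be \<open>dir x\<close>.\<close>
    have both: "R.ray (1 / Suc m) (1 / Suc n) (F x) (dir x)"
      by (rule R.ray_join[OF up _ ray']) simp_all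
    define \<delta> where "\<delta> = min (1 / real (Suc m)) (1 / real (Suc n))"
    have "0 < \<delta>" by (simp add: \<delta>_def)
    moreover have "R.ray \<delta> \<delta> (F x) (dir x)"
      using \<open>0 < \<delta>\<close> by (intro R.ray_shrink[OF both]) (auto simp: \<delta>_def)
    ultimately have "GDERIV w (F x) :> dir x" by (rule R.ray_GDERIV)
    moreover have "F x \<in> interior \<Omega>"
      using elim compact_imp_closed[OF compact] by (auto simp: frontier_def)
    ultimately have "descent_step \<Omega> \<eta> w (F x) = F x - \<eta> *\<^sub>R dir x"
      by (intro descent_step_GDERIV)
    moreover have "F x - \<eta> *\<^sub>R dir x = x - (a + \<eta>) *\<^sub>R dir x"
      using elim by (simp add: algebra_simps)
    ultimately show ?case by (rule trans)
  qed
qed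

end

lemma W1_initial: "W1 \<Omega> \<mu> \<nu> = (LINT x|\<mu>. norm (x - T x))"
  using W1_moved[of "\<lambda>x. x" 0] l_pos by (simp add: distr_id2)

text \<open>Position and remaining distance are proved together: the distance fixes the length of
  the next step, and the new position determines the next distance.\<close>

lemma descent_iterates:
  fixes \<theta> :: real and u :: "nat \<Rightarrow> 'a \<Rightarrow> real"
  defines "\<mu>s \<equiv> descent_measure \<Omega> \<theta> \<nu> u \<mu>" and "W \<equiv> W1 \<Omega> \<mu> \<nu>"
  assumes \<theta>: "0 < \<theta>" "\<theta> < 1" and W: "0 \<le> W"
    and pot: "\<And>m. m < n \<Longrightarrow> kantorovich_potential \<Omega> (\<mu>s m) \<nu> (u m)"
    and n: "(1 - (1 - \<theta>) ^ n) * W < l"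
  shows "W1 \<Omega> (\<mu>s n) \<nu> = (1 - \<theta>) ^ n * W"
proof -
  have "\<exists>F. F \<in> borel_measurable borel \<and> \<mu>s n = distr \<mu> borel F \<and>
      (AE x in \<mu>. F x = x - ((1 - (1 - \<theta>) ^ n) * W) *\<^sub>R dir x)"
    and "(1 - (1 - \<theta>) ^ n) * W < l \<and> W1 \<Omega> (\<mu>s n) \<nu> = (1 - \<theta>) ^ n * W"
    using pot n
  proof (induction n)
    case 0
    { case 1 show ?case
        by (intro exI[of _ "\<lambda>x. x"]) (simp add: \<mu>s_def distr_id2) }
    { case 2 show ?case using l_pos by (simp add: \<mu>s_def W_def) }
  next
    case (Suc n)
    let ?a = "\<lambda>n. (1 - (1 - \<theta>) ^ n) * W"
    have a_nonneg: "0 \<le> ?a n" for n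
      using \<theta> W by (intro mult_nonneg_nonneg) (simp_all add: power_le_one)
    \<comment> \<open>Serves both conclusions, since the distance after the step is computed from
      the new positions.\<close>
    have main: "\<exists>F. F \<in> borel_measurable borel \<and> \<mu>s (Suc n) = distr \<mu> borel F \<and>
      (AE x in \<mu>. F x = x - ?a (Suc n) *\<^sub>R dir x)"
      if pot: "\<And>m. m < Suc n \<Longrightarrow> kantorovich_potential \<Omega> (\<mu>s m) \<nu> (u m)" and lt: "?a (Suc n) < l"
    proof -
      have "(1 - \<theta>) ^ Suc n \<le> (1 - \<theta>) ^ n" using \<theta> by (simp add: mult_left_le_one_le)
      then have "?a n \<le> ?a (Suc n)" using W by (intro mult_right_mono) auto
      with lt have an: "?a n < l" by simp
      obtain F where F [measurable]: "F \<in> borel_measurable borel" and \<mu>F: "\<mu>s n = distr \<mu> borel F"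
        and FE: "AE x in \<mu>. F x = x - ?a n *\<^sub>R dir x"
        using Suc.IH(1)[OF pot an] by auto
      have W1n: "W1 \<Omega> (\<mu>s n) \<nu> = (1 - \<theta>) ^ n * W"
        using Suc.IH(2)[OF pot an] by simp
      note k = pot[OF lessI]
      have "\<Omega> \<noteq> {}" using T_in by blast
      then obtain w where w: "1-lipschitz_on UNIV w" and wu: "\<And>x. x \<in> \<Omega> \<Longrightarrow> w x = u n x"
        using lipschitz_extension[OF convex compact_imp_closed[OF compact], of "u n"] k
        unfolding kantorovich_potential_def by metis
      have kw: "kantorovich_potential \<Omega> (distr \<mu> borel F) \<nu> w"
        using k kantorovich_potential_cong[of \<Omega> w "u n"] wu unfolding \<mu>F by simp
      define \<eta> where "\<eta> = \<theta> * ((1 - \<theta>) ^ n * W)"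
      have step [measurable]: "descent_step \<Omega> \<eta> w \<in> borel_measurable borel"
        by (rule descent_step_measurable[OF lipschitz_on_continuous_on[OF w]])
      have "\<mu>s (Suc n) = distr (\<mu>s n) borel (descent_step \<Omega> \<eta> (u n))"
        using W1n by (simp add: \<mu>s_def \<eta>_def)
      also have "descent_step \<Omega> \<eta> (u n) = descent_step \<Omega> \<eta> w"
        by (rule descent_step_cong) (simp add: wu)
      also have "distr (\<mu>s n) borel (descent_step \<Omega> \<eta> w) = distr \<mu> borel (\<lambda>x. descent_step \<Omega> \<eta> w (F x))"
        unfolding \<mu>F by (simp add: distr_distr comp_def)
      finally have "\<mu>s (Suc n) = distr \<mu> borel (\<lambda>x. descent_step \<Omega> \<eta> w (F x))" .
      moreover have "AE x in \<mu>. descent_step \<Omega> \<eta> w (F x) = x - (?a n + \<eta>) *\<^sub>R dir x"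
        using F a_nonneg an FE
        by (intro descent_step_moved w potential_slope[OF F _ _ w kw] F_in F_slope) auto
      moreover have "?a n + \<eta> = ?a (Suc n)" by (simp add: \<eta>_def algebra_simps)
      ultimately show ?thesis
        by (intro exI[of _ "\<lambda>x. descent_step \<Omega> \<eta> w (F x)"]) simp
    qed
    { case 1 from main[OF this] show ?case . }
    { case 2
      obtain F where F: "F \<in> borel_measurable borel" "\<mu>s (Suc n) = distr \<mu> borel F"
        "AE x in \<mu>. F x = x - ?a (Suc n) *\<^sub>R dir x"
        using main[OF 2] by auto
      have "W1 \<Omega> (\<mu>s (Suc n)) \<nu> = W - ?a (Suc n)"
        unfolding F(2) W_def W1_initial using F a_nonneg[of "Suc n"] 2(2)
        by (intro W1_moved) (simp_all add: W_def W1_initial)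
      also have "\<dots> = (1 - \<theta>) ^ Suc n * W" by (simp only: left_diff_distrib)
      finally show ?case using 2(2) by simp }
  qed
  then show "W1 \<Omega> (\<mu>s n) \<nu> = (1 - \<theta>) ^ n * W" by simp
qed

end

text \<open>A constant value in \<open>\<Omega>\<close> replaces \<open>T\<^sub>0\<close> outside
  \<open>\<Omega>\<close>, where it is arbitrary. Composing the resulting map with any
  \<open>\<sigma>\<close> that preserves \<open>\<mu>\<close> gives an admissible competitor; this
  is the inequality behind cyclical monotonicity.\<close>

lemma optimal_transport_from_map:
  fixes \<Omega> :: "'a::euclidean_space set" and \<mu> \<nu> :: "'a measure"
  assumes compact: "compact \<Omega>" and convex: "convex \<Omega>"
    and \<mu>: "\<mu> \<in> prob_measures_on \<Omega>" and \<nu>: "\<nu> \<in> prob_measures_on \<Omega>"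
    and ac: "absolutely_continuous lborel \<mu>"
    and opt: "optimal_transport_map \<Omega> \<mu> \<nu> T\<^sub>0"
  obtains T v where "optimal_transport \<Omega> \<mu> \<nu> T v" "\<forall>x\<in>\<Omega>. T x = T\<^sub>0 x"
proof -
  have \<Omega>b [measurable]: "\<Omega> \<in> sets borel" using compact by (intro borel_closed compact_imp_closed)
  note \<mu>D = prob_measures_onD[OF \<mu> \<Omega>b]
  note [measurable_cong] = \<mu>D(2)
  interpret M: prob_space \<mu> by (rule \<mu>D)
  have "\<Omega> \<noteq> {}" using \<mu> by (auto simp: prob_measures_on_def)
  then obtain c where c: "c \<in> \<Omega>" by blast
  have T0: "T\<^sub>0 \<in> restrict_space borel \<Omega> \<rightarrow>\<^sub>M restrict_space borel \<Omega>"
    and T0_push: "distr (restrict_space \<mu> \<Omega>) borel T\<^sub>0 = \<nu>"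
    using opt by (auto simp: optimal_transport_map_def transport_maps_def)
  define T where "T x = (if x \<in> \<Omega> then T\<^sub>0 x else c)" for x
  have T_in: "T x \<in> \<Omega>" for x
    using measurable_space[OF T0, of x] c by (auto simp: T_def space_restrict_space)
  have T [measurable]: "T \<in> borel_measurable borel"
  proof -
    have "T\<^sub>0 \<in> borel_measurable (restrict_space borel \<Omega>)"
      using T0 by (simp add: measurable_restrict_space2_iff)
    then have "(\<lambda>x. indicator \<Omega> x *\<^sub>R T\<^sub>0 x) \<in> borel_measurable borel"
      by (subst (asm) borel_measurable_restrict_space_iff) auto
    then have "(\<lambda>x. indicator \<Omega> x *\<^sub>R T\<^sub>0 x + indicator (- \<Omega>) x *\<^sub>R c) \<in> borel_measurable borel"
      by measurable
    also have "(\<lambda>x. indicator \<Omega> x *\<^sub>R T\<^sub>0 x + indicator (- \<Omega>) x *\<^sub>R c) = T"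
      by (auto simp: T_def)
    finally show ?thesis .
  qed
  have T_push: "distr \<mu> borel T = \<nu>"
    using distr_restrict_full[OF \<mu>D(2) \<Omega>b \<mu>D(4) T, of T\<^sub>0] T0_push by (simp add: T_def)
  have cost: "(LINT x:\<Omega>|\<mu>. norm (x - S' x)) = (LINT x|\<mu>. dist x (S x))"
    if S: "S \<in> borel_measurable borel" "\<And>x. x \<in> \<Omega> \<Longrightarrow> S' x = S x" for S S'
  proof -
    note S(1) [measurable]
    have "(LINT x:\<Omega>|\<mu>. norm (x - S' x)) = (LINT x:\<Omega>|\<mu>. norm (x - S x))"
      using S(2) by (intro set_integral_eq_on) auto
    also have "\<dots> = (LINT x|\<mu>. norm (x - S x))"
      using \<mu>D \<Omega>b by (intro set_integral_full) auto
    finally show ?thesis by (simp add: dist_norm)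
  qed
  interpret A: atomless_prob \<mu>
  proof
    show "sets \<mu> = sets borel" by (rule \<mu>D)
    show "measure \<mu> {x} = 0" for x
    proof -
      have "{x} \<in> null_sets lborel" by (intro null_setsI) auto
      then have "{x} \<in> null_sets \<mu>" using ac by (auto simp: absolutely_continuous_def)
      then show ?thesis by (rule measure_eq_0_null_sets)
    qed
  qed
  have "(LINT x|\<mu>. dist x (T x)) \<le> (LINT x|\<mu>. dist x (T (\<sigma> x)))"
    if \<sigma> [measurable]: "\<sigma> \<in> borel_measurable borel" and \<sigma>\<mu>: "distr \<mu> borel \<sigma> = \<mu>" for \<sigma>
  proof -
    have T\<sigma> [measurable]: "(\<lambda>x. T (\<sigma> x)) \<in> borel_measurable borel" by measurable
    have "distr \<mu> borel (\<lambda>x. T (\<sigma> x)) = distr (distr \<mu> borel \<sigma>) borel T"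
      by (simp add: distr_distr comp_def)
    then have "distr (restrict_space \<mu> \<Omega>) borel (\<lambda>x. T (\<sigma> x)) = \<nu>"
      using distr_restrict_full[OF \<mu>D(2) \<Omega>b \<mu>D(4) T\<sigma>] by (simp add: \<sigma>\<mu> T_push)
    moreover have "(\<lambda>x. T (\<sigma> x)) \<in> restrict_space borel \<Omega> \<rightarrow>\<^sub>M restrict_space borel \<Omega>"
      by (rule measurable_restrict_space2) (auto simp: T_in intro!: measurable_restrict_space1)
    ultimately have "(\<lambda>x. T (\<sigma> x)) \<in> transport_maps \<Omega> \<mu> \<nu>" by (simp add: transport_maps_def)
    then have "(LINT x:\<Omega>|\<mu>. norm (x - T\<^sub>0 x)) \<le> (LINT x:\<Omega>|\<mu>. norm (x - T (\<sigma> x)))"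
      using opt by (simp add: optimal_transport_map_def)
    then show ?thesis using cost[OF T, of T\<^sub>0] cost[OF T\<sigma>] by (simp add: T_def)
  qed
  then obtain v :: "'a \<Rightarrow> real" where v: "1-lipschitz_on UNIV v" "AE x in \<mu>. v x - v (T x) = dist x (T x)"
    using A.optimal_map_potential[OF T compact_imp_bounded[OF compact] \<mu>D(4) T_in] by metis
  have "optimal_transport \<Omega> \<mu> \<nu> T v"
    using v by unfold_locales (simp_all add: compact convex \<mu> \<nu> ac T_in T_push dist_norm)
  then show thesis by (rule that) (simp add: T_def)
qed

section \<open>The essential infimum of the displacement\<close>

context optimal_transport
begin

lemma displacement_level_borel: "{x \<in> \<Omega>. norm (x - T x) < r} \<in> sets borel"
proof -
  have "{x. norm (x - T x) < r} \<in> sets borel" by measurable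
  then have "\<Omega> \<inter> {x. norm (x - T x) < r} \<in> sets borel" by (intro sets.Int) auto
  then show ?thesis by (simp add: Int_def)
qed

lemma AE_displacement_ge:
  "emeasure \<mu> {x \<in> \<Omega>. norm (x - T x) < r} = 0 \<longleftrightarrow> (AE x in \<mu>. r \<le> norm (x - T x))"
proof
  assume "emeasure \<mu> {x \<in> \<Omega>. norm (x - T x) < r} = 0"
  then have "{x \<in> \<Omega>. norm (x - T x) < r} \<in> null_sets \<mu>"
    using displacement_level_borel by auto
  then have "AE x in \<mu>. x \<notin> {x \<in> \<Omega>. norm (x - T x) < r}" by (rule AE_not_in)
  then show "AE x in \<mu>. r \<le> norm (x - T x)" using AE_\<Omega> by eventually_elim auto
next
  assume "AE x in \<mu>. r \<le> norm (x - T x)"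
  then have "emeasure \<mu> {x \<in> \<Omega>. norm (x - T x) < r} = emeasure \<mu> {}"
    using displacement_level_borel by (intro emeasure_eq_AE) (auto elim!: eventually_mono)
  then show "emeasure \<mu> {x \<in> \<Omega>. norm (x - T x) < r} = 0" by simp
qed

lemma AE_displacement_ge_le:
  assumes "AE x in \<mu>. r \<le> norm (x - T x)"
  shows "r \<le> (LINT x|\<mu>. norm (x - T x))"
proof -
  have "(LINT x|\<mu>. r) \<le> (LINT x|\<mu>. norm (x - T x))"
    using displacement_integrable[OF M.prob_space_axioms, of "\<lambda>x. x" T] AE_\<Omega> T_in assms
    by (intro integral_mono_AE) auto
  then show ?thesis by simp
qed

text \<open>An essential infimum is at most the mean, and the mean displacement is \<open>W1\<close>
  because of \<open>v\<close>; this also bounds the set whose supremum is taken. The second part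
  supplies the \<open>l\<close> of the separated situation.\<close>

lemma min_displacement_props:
  shows "min_displacement \<Omega> \<mu> T \<le> W1 \<Omega> \<mu> \<nu>"
    and "r < min_displacement \<Omega> \<mu> T \<Longrightarrow> \<exists>l>r. AE x in \<mu>. l \<le> norm (x - T x)"
proof -
  let ?S = "{r. AE x in \<mu>. r \<le> norm (x - T x)}"
  have W: "W1 \<Omega> \<mu> \<nu> = (LINT x|\<mu>. norm (x - T x))"
    using W1_push[of "\<lambda>x. x"] AE_\<Omega> v_slope by (simp add: distr_id2)
  have def: "min_displacement \<Omega> \<mu> T = Sup ?S"
    unfolding min_displacement_def AE_displacement_ge ..
  have 0: "0 \<in> ?S" by simp
  then have ne: "?S \<noteq> {}" by blast
  have le: "r \<le> W1 \<Omega> \<mu> \<nu>" if "r \<in> ?S" for r using that AE_displacement_ge_le W by simp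
  then have bdd: "bdd_above ?S" by (rule bdd_aboveI)
  show "min_displacement \<Omega> \<mu> T \<le> W1 \<Omega> \<mu> \<nu>" unfolding def by (rule cSup_least[OF ne le])
  show "\<exists>l>r. AE x in \<mu>. l \<le> norm (x - T x)" if "r < min_displacement \<Omega> \<mu> T"
    using that unfolding def less_cSup_iff[OF ne bdd] by blast
qed

end

text \<open>For an integer n, being at most the ceiling of x minus 1 means n < x, and a logarithm to
  a base below 1 reverses the order. For l = W every n is allowed, and strictness comes from (1 -
  \<theta>)^n > 0.\<close>

lemma last_index_less:
  assumes \<theta>: "0 < \<theta>" "\<theta> < 1" and W: "0 < W" and l: "l \<le> W" and n: "ereal (real n) \<le> last_index \<theta> l W"
  shows "(1 - (1 - \<theta>) ^ n) * W < l"
proof (cases "l = W")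
  case True
  have "0 < (1 - \<theta>) ^ n" using \<theta> by simp
  then show ?thesis using True W by (simp add: left_diff_distrib)
next
  case False
  define r where "r = 1 - l / W"
  have r: "0 < r" using False l W by (simp add: r_def field_simps)
  have "real n \<le> of_int (\<lceil>log (1 - \<theta>) r\<rceil> - 1)"
    using n False by (simp add: last_index_def r_def)
  then have "real n < log (1 - \<theta>) r" by linarith
  then have "real n < ln r / ln (1 - \<theta>)" by (simp add: log_def)
  moreover have "ln (1 - \<theta>) < 0" using \<theta> by simp
  ultimately have "ln r < real n * ln (1 - \<theta>)" by (simp add: neg_less_divide_eq)
  also have "\<dots> = ln ((1 - \<theta>) ^ n)" using \<theta> by (simp add: ln_realpow)
  finally have "r < (1 - \<theta>) ^ n" using r \<theta> by simp
  then have "(1 - (1 - \<theta>) ^ n) * W < (1 - r) * W" using W by simp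
  then show ?thesis using W by (simp add: r_def)
qed

text \<open>By the ceiling, n + 1 is at least the logarithm, so one more factor 1 - \<theta> would
  bring the value to at most W - l; dividing by this factor gives the bound.\<close>

lemma last_index_bound:
  assumes \<theta>: "0 < \<theta>" "\<theta> < 1" and W: "0 < W" and l: "l < W" and n: "ereal (real n) = last_index \<theta> l W"
  shows "(1 - \<theta>) ^ n * W \<le> (W - l) / (1 - \<theta>)"
proof -
  define r where "r = 1 - l / W"
  have r: "0 < r" using l W by (simp add: r_def field_simps)
  have "real n = of_int (\<lceil>log (1 - \<theta>) r\<rceil> - 1)"
    using n l by (simp add: last_index_def r_def)
  then have "log (1 - \<theta>) r \<le> real (Suc n)" by linarith
  then have "ln r / ln (1 - \<theta>) \<le> real (Suc n)" by (simp add: log_def)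
  moreover have "ln (1 - \<theta>) < 0" using \<theta> by simp
  ultimately have "real (Suc n) * ln (1 - \<theta>) \<le> ln r" by (simp only: neg_divide_le_eq)
  then have "ln ((1 - \<theta>) ^ Suc n) \<le> ln r" using \<theta> by (simp only: ln_realpow)
  then have "(1 - \<theta>) ^ Suc n \<le> r" using r \<theta> by (subst (asm) ln_le_cancel_iff) simp_all
  then have "(1 - \<theta>) ^ Suc n * W \<le> r * W" using W by (intro mult_right_mono) auto
  also have "r * W = W - l" using W by (simp add: r_def field_simps)
  finally show ?thesis using \<theta> by (simp add: field_simps)
qed

theorem theorem2:
  fixes \<Omega> :: "'a::euclidean_space set"
    and \<mu> \<nu> :: "'a measure"
    and \<theta> :: real
    and T\<^sub>0 :: "'a \<Rightarrow> 'a"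
    and u :: "nat \<Rightarrow> 'a \<Rightarrow> real"
    and \<mu>s :: "nat \<Rightarrow> 'a measure"
    and l\<^sub>0 :: real
    and N :: ereal
  assumes "compact \<Omega>" and "convex \<Omega>"
    and "\<mu> \<in> prob_measures_on \<Omega>" and "\<nu> \<in> prob_measures_on \<Omega>"
    and "\<exists>\<rho> \<in> borel_measurable lborel. \<mu> = density lborel \<rho>"
    and "W1 \<Omega> \<mu> \<nu> > 0"
    and "0 < \<theta>" and "\<theta> < 1"
    and "optimal_transport_map \<Omega> \<mu> \<nu> T\<^sub>0"
  defines "\<mu>s \<equiv> descent_measure \<Omega> \<theta> \<nu> u \<mu>"
    and "l\<^sub>0 \<equiv> min_displacement \<Omega> \<mu> T\<^sub>0"
    and "N \<equiv> last_index \<theta> l\<^sub>0 (W1 \<Omega> \<mu> \<nu>)"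
  assumes "\<And>n. ereal (real n) < N \<Longrightarrow> kantorovich_potential \<Omega> (\<mu>s n) \<nu> (u n)"
  shows "(\<forall>n. ereal (real n) \<le> N \<longrightarrow> W1 \<Omega> (\<mu>s n) \<nu> = (1 - \<theta>) ^ n * W1 \<Omega> \<mu> \<nu>) \<and>
         (l\<^sub>0 < W1 \<Omega> \<mu> \<nu> \<longrightarrow>
            (\<forall>n. ereal (real n) = N \<longrightarrow> W1 \<Omega> (\<mu>s n) \<nu> \<le> (W1 \<Omega> \<mu> \<nu> - l\<^sub>0) / (1 - \<theta>)))"
proof -
  have ac: "absolutely_continuous lborel \<mu>"
    using assms(5) by (auto intro: absolutely_continuousI_density)
  obtain T v where "optimal_transport \<Omega> \<mu> \<nu> T v" and TT\<^sub>0: "\<forall>x\<in>\<Omega>. T x = T\<^sub>0 x"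
    by (rule optimal_transport_from_map[OF assms(1-4) ac assms(9)])
  then interpret optimal_transport \<Omega> \<mu> \<nu> T v by blast
  have "{x \<in> \<Omega>. norm (x - T\<^sub>0 x) < l} = {x \<in> \<Omega>. norm (x - T x) < l}" for l
    using TT\<^sub>0 by auto
  then have l\<^sub>0: "l\<^sub>0 = min_displacement \<Omega> \<mu> T"
    unfolding l\<^sub>0_def min_displacement_def by simp
  have contraction: "W1 \<Omega> (\<mu>s n) \<nu> = (1 - \<theta>) ^ n * W1 \<Omega> \<mu> \<nu>" if n: "ereal (real n) \<le> N" for n
  proof -
    have "(1 - (1 - \<theta>) ^ n) * W1 \<Omega> \<mu> \<nu> < l\<^sub>0"
      using n min_displacement_props(1) assms(6-8) unfolding N_def l\<^sub>0
      by (intro last_index_less) auto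
    \<comment> \<open>This \<open>l\<close> exceeds the nonnegative distance moved in n steps, so it
      is positive as well.\<close>
    then obtain l where l: "(1 - (1 - \<theta>) ^ n) * W1 \<Omega> \<mu> \<nu> < l" "AE x in \<mu>. l \<le> norm (x - T x)"
      unfolding l\<^sub>0 using min_displacement_props(2) by blast
    have "0 \<le> (1 - (1 - \<theta>) ^ n) * W1 \<Omega> \<mu> \<nu>"
      using assms(6-8) by (intro mult_nonneg_nonneg) (simp_all add: power_le_one)
    then interpret separated_transport \<Omega> \<mu> \<nu> T v l
      using l by unfold_locales auto
    show ?thesis
      unfolding \<mu>s_def
    proof (rule descent_iterates)
      fix m assume "m < n"
      then have "ereal (real m) < ereal (real n)" by simp
      then show "kantorovich_potential \<Omega> (descent_measure \<Omega> \<theta> \<nu> u \<mu> m) \<nu> (u m)"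
        using assms(13)[of m] n unfolding \<mu>s_def by (meson less_le_trans)
    qed (use assms(6-8) l in auto)
  qed
  moreover have "W1 \<Omega> (\<mu>s n) \<nu> \<le> (W1 \<Omega> \<mu> \<nu> - l\<^sub>0) / (1 - \<theta>)" if "l\<^sub>0 < W1 \<Omega> \<mu> \<nu>" "ereal (real n) = N" for n
    using contraction[of n] last_index_bound[OF assms(7,8,6) that(1), of n] that(2)
    unfolding N_def by simp
  ultimately show ?thesis by blast
qed

end
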